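(* Let $X$ be a non-trivial complex Banach space and let $1\le p<\infty$. (i) Let $I=\mathbb{R}$ or $I=[0,\infty)$. Then $S^pAAA(I:X)\cap S^pQ\text{-}AAP(I:X)=S^pAAP(I:X)$ and $[S^pAAA(I:X)\setminus S^pAAP(I:X)]\cap S^pQ\text{-}AAP(I:X)=\emptyset$. (ii) $S^pAA(\mathbb{R}:X)\cap S^pQ\text{-}AAP(\mathbb{R}:X)=S^pAP(\mathbb{R}:X)$.
   Context: $L_S^p(I:X)$ is the space of $S^p$-bounded (Stepanov $p$-bounded) functions: $f\in L^p_{loc}(I:X)$ with $\|f\|_{S^p}:=\sup_{t\in I}\bigl(\int_t^{t+1}\|f(s)\|^p\,ds\bigr)^{1/p}<\infty$. For such $f$, define $\hat f:I\to L^p([0,1]:X)$ by $\hat f(t)(s):=f(t+s)$, $t\in I$, $s\in[0,1]$. For a Banach space $Z$, $C_0(I:Z)$ is the space of bounded continuous $f:I\to Z$ with $\lim_{|t|\to\infty}\|f(t)\|=0$. A continuous $f:I\to Z$ is almost periodic if for each $\epsilon>0$ the set $\{\tau>0:\|f(t+\tau)-f(t)\|\le\epsilon\ \forall t\in I\}$ is relatively dense in $I$ (there is $l>0$ such that any subinterval of $I$ of length $l$ meets it). A bounded continuous $f:I\to Z$ is asymptotically almost periodic if for every $\epsilon>0$ there are $l>0$, $M>0$ such that every subinterval of $I$ of length $l$ contains at least one $\tau$ with $\|f(t+\tau)-f(t)\|\le\epsilon$ whenever $|t|,|t+\tau|\ge M$ (with $t,t+\tau\in I$); equivalently, $f$ is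 the sum of an almost periodic function $I\to Z$ and an element of $C_0(I:Z)$. $S^pAP(I:X)$ (Stepanov $p$-almost periodic): those $f\in L_S^p(I:X)$ with $\hat f$ almost periodic. $S^pAAP(I:X)$ (asymptotically Stepanov $p$-almost periodic): those $f\in L_S^p(I:X)$ with $\hat f$ asymptotically almost periodic. $S^pAA(\mathbb{R}:X)$ (Stepanov $p$-almost automorphic): those $f\in L^p_{loc}(\mathbb{R}:X)$ such that for every real sequence $(a_n)$ there exist a subsequence $(a_{n_k})$ and $g\in L^p_{loc}(\mathbb{R}:X)$ with $\lim_{k\to\infty}\int_t^{t+1}\|f(a_{n_k}+s)-g(s)\|^p\,ds=0$ and $\lim_{k\to\infty}\int_t^{t+1}\|g(s-a_{n_k})-f(s)\|^p\,ds=0$ for each $t\in\mathbb{R}$. $S^pAAA(I:X)$ (asymptotically Stepanov $p$-almost automorphic): $S^p$-bounded $f:I\to X$ for which there exist $h\in S^pAA(\mathbb{R}:X)$ and an $S^p$-bounded $q:I\to X$ with $\hat q\in C_0(I:L^p([0,1]:X))$ and $f=h+q$ a.e. on $I$. $S^pQ\text{-}AAP(I:X)$ (Stepanov $p$-quasi-asymptotically almost periodic): those $f\in L_S^p(I:X)$ such that for each $\epsilon>0$ there exists a finite number $L(\epsilon)>0$ such that any interval $I'\subseteq I$ of length $L(\epsilon)$ contains at least one number $\tau\in I'$ for which there exists a finite number $M(\epsilon,\tau)>0$ with $\int_t^{t+1}\|f(s+\tau)-f(s)\|^p\,ds\le\epsilon^p$ for all $t\in I$ with $|t|\ge M(\e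psilon,\tau)$.
   Formalization: For I = ℝ, the set of τ > 0 in the definition of almost periodicity is required to be relatively dense in [0,∞) rather than in ℝ (which no set of positive numbers can be); this is Bohr's usual notion. *)

theory Defs
  imports "HOL-Analysis.Analysis"
begin

class complex_banach = banach +
  fixes scaleC :: "complex \<Rightarrow> 'a \<Rightarrow> 'a"
  assumes scaleC_add_right: "scaleC a (x + y) = scaleC a x + scaleC a y"
    and scaleC_add_left: "scaleC (a + b) x = scaleC a x + scaleC b x"
    and scaleC_scaleC: "scaleC a (scaleC b x) = scaleC (a * b) x"
    and scaleC_of_real: "scaleC (complex_of_real r) x = r *\<^sub>R x"
    and norm_scaleC: "norm (scaleC a x) = cmod a * norm x"

instantiation complex :: complex_banach
begin

definition scaleC_complex :: "complex \<Rightarrow> complex \<Rightarrow> complex" where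
  "scaleC_complex a x = a * x"

instance
  by standard (auto simp: scaleC_complex_def algebra_simps norm_mult scaleR_conv_of_real)

end

text \<open>
  A function on an interval \<open>I\<close> is a total function on the reals of which only the values on
  \<open>I\<close> are used, and elements of Lebesgue spaces are represented by functions. All the sets of
  functions below are closed under changing values outside \<open>I\<close> and on null sets.
\<close>

text \<open>
  Strong (Bochner) measurability. For a nonseparable range space this is more than Borel
  measurability.
\<close>

definition strongly_measurable :: "'b measure \<Rightarrow> ('b \<Rightarrow> 'a::real_normed_vector) \<Rightarrow> bool" where
  "strongly_measurable M f \<longleftrightarrow>
     (\<exists>s. (\<forall>i::nat. simple_function M (s i)) \<and> (AE x in M. (\<lambda>i. s i x) \<longlonglongrightarrow> f x))"

definition Lp_loc :: "real \<Rightarrow> real set \<Rightarrow> (real \<Rightarrow> 'a::banach) set" where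
  "Lp_loc p I = {f. strongly_measurable (lebesgue_on I) f \<and>
     (\<forall>K. compact K \<and> K \<subseteq> I \<longrightarrow> set_integrable lebesgue K (\<lambda>s. norm (f s) powr p))}"

definition Lp_norm :: "real \<Rightarrow> real set \<Rightarrow> (real \<Rightarrow> 'a::banach) \<Rightarrow> real" where
  "Lp_norm p A f = (LINT s:A|lebesgue. norm (f s) powr p) powr (1 / p)"

text \<open>Finiteness of the supremum defining the Stepanov norm is expressed by \<open>bdd_above\<close>.\<close>

definition stepanov_bounded :: "real \<Rightarrow> real set \<Rightarrow> (real \<Rightarrow> 'a::banach) set" where
  "stepanov_bounded p I = {f \<in> Lp_loc p I. bdd_above ((\<lambda>t. Lp_norm p {t..t + 1} f) ` I)}"

text \<open>
  The value \<open>bochner_transform f t\<close> represents an element of $L^p([0,1]:X)$; its values outside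
  $[0,1]$ are irrelevant, as it is only ever measured by \<open>Lp_norm p {0..1}\<close>.
\<close>

definition bochner_transform :: "(real \<Rightarrow> 'a) \<Rightarrow> real \<Rightarrow> real \<Rightarrow> 'a" where
  "bochner_transform f t = (\<lambda>s. f (t + s))"

text \<open>
  In the next definitions \<open>N\<close> is the norm of the range space \<open>Z\<close>. It is a parameter because the
  norm of $L^p([0,1]:X)$ depends on the real number \<open>p\<close> and so cannot be the class constant
  \<open>norm\<close> of a type. On representatives it is a seminorm, whose null space consists of the
  functions vanishing almost everywhere on $[0,1]$.
\<close>

definition continuous_wrt :: "('z::minus \<Rightarrow> real) \<Rightarrow> real set \<Rightarrow> (real \<Rightarrow> 'z) \<Rightarrow> bool" where
  "continuous_wrt N I F \<longleftrightarrow> (\<forall>t\<in>I. ((\<lambda>s. N (F s - F t)) \<longlongrightarrow> 0) (at t within I))"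

definition bounded_wrt :: "('z \<Rightarrow> real) \<Rightarrow> real set \<Rightarrow> (real \<Rightarrow> 'z) \<Rightarrow> bool" where
  "bounded_wrt N I F \<longleftrightarrow> (\<exists>B. \<forall>t\<in>I. N (F t) \<le> B)"

definition C0_wrt :: "('z::minus \<Rightarrow> real) \<Rightarrow> real set \<Rightarrow> (real \<Rightarrow> 'z) set" where
  "C0_wrt N I = {F. continuous_wrt N I F \<and> bounded_wrt N I F \<and>
     ((\<lambda>t. N (F t)) \<longlongrightarrow> 0) (inf at_infinity (principal I))}"

definition relatively_dense_in :: "real set \<Rightarrow> real set \<Rightarrow> bool" where
  "relatively_dense_in J T \<longleftrightarrow> (\<exists>l>0. \<forall>a. {a..a + l} \<subseteq> J \<longrightarrow> (\<exists>\<tau>\<in>{a..a + l}. \<tau> \<in> T))"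

text \<open>
  Positive \<open>\<epsilon>\<close>-periods cannot meet intervals of negative numbers, so they are required to be
  relatively dense in the half-line also when \<open>I\<close> is the real line. In that case \<open>-\<tau>\<close> is an
  \<open>\<epsilon>\<close>-period whenever \<open>\<tau>\<close> is, and this is Bohr's condition.
\<close>

definition almost_periodic_wrt :: "('z::minus \<Rightarrow> real) \<Rightarrow> real set \<Rightarrow> (real \<Rightarrow> 'z) set" where
  "almost_periodic_wrt N I = {F. continuous_wrt N I F \<and>
     (\<forall>\<epsilon>>0. relatively_dense_in {0..} {\<tau>. \<tau> > 0 \<and> (\<forall>t\<in>I. N (F (t + \<tau>) - F t) \<le> \<epsilon>)})}"

definition asymptotically_almost_periodic_wrt ::
    "('z::minus \<Rightarrow> real) \<Rightarrow> real set \<Rightarrow> (real \<Rightarrow> 'z) set" where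
  "asymptotically_almost_periodic_wrt N I = {F. continuous_wrt N I F \<and> bounded_wrt N I F \<and>
     (\<forall>\<epsilon>>0. \<exists>M>0. relatively_dense_in I
        {\<tau>. \<forall>t\<in>I. t + \<tau> \<in> I \<and> \<bar>t\<bar> \<ge> M \<and> \<bar>t + \<tau>\<bar> \<ge> M \<longrightarrow> N (F (t + \<tau>) - F t) \<le> \<epsilon>})}"

definition SpAP :: "real \<Rightarrow> real set \<Rightarrow> (real \<Rightarrow> 'a::banach) set" where
  "SpAP p I = {f \<in> stepanov_bounded p I.
     bochner_transform f \<in> almost_periodic_wrt (Lp_norm p {0..1}) I}"

definition SpAAP :: "real \<Rightarrow> real set \<Rightarrow> (real \<Rightarrow> 'a::banach) set" where
  "SpAAP p I = {f \<in> stepanov_bounded p I.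
     bochner_transform f \<in> asymptotically_almost_periodic_wrt (Lp_norm p {0..1}) I}"

definition SpAA :: "real \<Rightarrow> (real \<Rightarrow> 'a::banach) set" where
  "SpAA p = {f \<in> Lp_loc p UNIV. \<forall>a::nat \<Rightarrow> real. \<exists>r. strict_mono r \<and> (\<exists>g \<in> Lp_loc p UNIV. \<forall>t.
     (\<lambda>k. LINT s:{t..t + 1}|lebesgue. norm (f (a (r k) + s) - g s) powr p) \<longlonglongrightarrow> 0 \<and>
     (\<lambda>k. LINT s:{t..t + 1}|lebesgue. norm (g (s - a (r k)) - f s) powr p) \<longlonglongrightarrow> 0)}"

definition SpAAA :: "real \<Rightarrow> real set \<Rightarrow> (real \<Rightarrow> 'a::banach) set" where
  "SpAAA p I = {f \<in> stepanov_bounded p I. \<exists>h \<in> SpAA p. \<exists>q \<in> stepanov_bounded p I.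
     bochner_transform q \<in> C0_wrt (Lp_norm p {0..1}) I \<and>
     (AE t in lebesgue_on I. f t = h t + q t)}"

definition SpQAAP :: "real \<Rightarrow> real set \<Rightarrow> (real \<Rightarrow> 'a::banach) set" where
  "SpQAAP p I = {f \<in> stepanov_bounded p I. \<forall>\<epsilon>>0. relatively_dense_in I
     {\<tau>. \<exists>M>0. \<forall>t\<in>I. \<bar>t\<bar> \<ge> M \<longrightarrow>
        (LINT s:{t..t + 1}|lebesgue. norm (f (s + \<tau>) - f s) powr p) \<le> \<epsilon> powr p}}"

end

theory Submission
  imports Defs "HOL-Library.Diagonal_Subsequence"
begin

text \<open>
  For a function \<open>f\<close>, extended by zero outside \<open>I\<close>, let \<open>d t u\<close> be the distance in $L^p([0,1])$ of its
  translates by \<open>t\<close> and \<open>u\<close>; then \<open>\<tau>\<close> is an \<open>\<epsilon>\<close>-period when \<open>d (t + \<tau>) t \<le> \<epsilon>\<close> for all \<open>t\<close>.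
  If \<open>h\<close> is almost automorphic and \<open>d (t + \<tau>) t \<le> \<epsilon>\<close> holds only for large \<open>t\<close>, then passing to the
  limit of the translates by a subsequence of \<open>1, 2, 3, \<dots>\<close> and back again shows that \<open>\<tau>\<close> is an
  \<open>\<epsilon>\<close>-period of \<open>h\<close>. So quasi-asymptotic periods of \<open>h + q\<close>, with \<open>q\<close> vanishing at infinity, are
  genuine periods of \<open>h\<close> and therefore asymptotic periods of \<open>h + q\<close>, with a threshold that depends
  only on \<open>q\<close>.

  Conversely, almost periodicity implies almost automorphy by Bochner's criterion. If \<open>f\<close> is
  asymptotically almost periodic, choose asymptotic \<open>2\<^sup>-\<^sup>n\<close>-periods \<open>\<tau>\<^sub>n \<ge> n\<close>. The translates of \<open>f\<close> by
  \<open>\<tau>\<^sub>n\<close> form a Cauchy sequence, without passing to a subsequence, because two of them can be compared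
  after a further shift by an asymptotic period to where both \<open>\<tau>\<^sub>n\<close> and \<open>\<tau>\<^sub>m\<close> are effective. The limit
  is the almost periodic part of \<open>f\<close>.
\<close>

subsection \<open>Minkowski's inequality and strong measurability\<close>

lemma powr_inverse_powr:
  fixes x p :: real
  assumes "0 \<le> x" "1 \<le> p"
  shows "(x powr (1 / p)) powr p = x" "(x powr p) powr (1 / p) = x"
  using assms by (auto simp: powr_powr)

text \<open>Convexity of \<open>x powr p\<close> for the weights \<open>a / (a + b)\<close> and
  \<open>b / (a + b)\<close>, with \<open>u\<close> and \<open>v\<close> rescaled so that the convex
  combination is \<open>u + v\<close>. The parameters \<open>a\<close> and \<open>b\<close> stay
  free because Minkowski's inequality takes them to be the two norms.\<close>

lemma convex_powr_sum_le:
  fixes p :: real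
  assumes p: "1 \<le> p" and a: "0 < a" and b: "0 < b" and u: "0 \<le> u" and v: "0 \<le> v"
  shows "(u + v) powr p \<le> (a + b) powr (p - 1) * (a powr (1 - p) * u powr p + b powr (1 - p) * v powr p)"
proof -
  \<comment> \<open>If one summand vanishes, the term of the other one suffices by monotonicity of
    \<open>powr\<close>. This leaves strictly positive points for the convexity argument.\<close>
  have *: "u powr p \<le> (a + b) powr (p - 1) * (a powr (1 - p) * u powr p)" if "0 < a" "0 < b" "0 \<le> u" for a b u
  proof -
    have "a powr (p - 1) \<le> (a + b) powr (p - 1)"
      using that p by (intro powr_mono2) auto
    then have "1 \<le> (a + b) powr (p - 1) * a powr (1 - p)"
      using that by (simp add: powr_minus_divide[of a "p - 1", simplified] field_simps)
    then show ?thesis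
      using mult_right_mono[of 1 "(a + b) powr (p - 1) * a powr (1 - p)" "u powr p"] by (simp add: mult.assoc)
  qed
  consider "u = 0" | "v = 0" | "0 < u" "0 < v" using u v by linarith
  then show ?thesis
  proof cases
    case 1
    then show ?thesis using *[of b a v] a b v by (simp add: add.commute)
  next
    case 2
    then show ?thesis using *[of a b u] a b u by simp
  next
    case 3
    define x where "x = u * (a + b) / a"
    define y where "y = v * (a + b) / b"
    have xy: "0 < x" "0 < y" using 3 a b by (auto simp: x_def y_def)
    have "(a / (a + b)) *\<^sub>R x + (b / (a + b)) *\<^sub>R y = u + v"
      using a b by (simp add: x_def y_def)
    moreover have "((a / (a + b)) *\<^sub>R x + (b / (a + b)) *\<^sub>R y) powr p
        \<le> (a / (a + b)) * x powr p + (b / (a + b)) * y powr p"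
      using xy a b by (intro powr_convex[OF p, unfolded convex_on_def, THEN conjunct2, rule_format]) (auto simp: divide_simps)
    moreover have "(a / (a + b)) * x powr p = (a + b) powr (p - 1) * (a powr (1 - p) * u powr p)"
      proof -
      have "x powr p = u powr p * (a + b) powr p / a powr p"
        using a b 3 unfolding x_def by (simp add: powr_mult powr_divide)
      then show ?thesis using a b by (simp add: powr_diff)
    qed
    moreover have "(b / (a + b)) * y powr p = (a + b) powr (p - 1) * (b powr (1 - p) * v powr p)"
      proof -
      have "y powr p = v powr p * (a + b) powr p / b powr p"
        using a b 3 unfolding y_def by (simp add: powr_mult powr_divide)
      then show ?thesis using a b by (simp add: powr_diff)
    qed
    ultimately show ?thesis by (simp add: distrib_left)
  qed
qed

lemma powr_sum_le:
  fixes p :: real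
  assumes "1 \<le> p" "0 \<le> u" "0 \<le> v"
  shows "(u + v) powr p \<le> 2 powr (p - 1) * (u powr p + v powr p)"
  using convex_powr_sum_le[of p 1 1 u v] assms by simp

text \<open>With \<open>a\<close> and \<open>b\<close> close to the norms of \<open>U\<close> and
  \<open>V\<close>, the integrated convexity bound collapses: each bracket is at most
  \<open>a powr (1 - p) * a powr p = a\<close>, so the total is
  \<open>(a + b) powr p\<close>.\<close>

lemma minkowski_real:
  fixes U V :: "'b \<Rightarrow> real"
  assumes p: "1 \<le> p" and UV: "\<And>x. 0 \<le> U x" "\<And>x. 0 \<le> V x"
    and int: "integrable M (\<lambda>x. U x powr p)" "integrable M (\<lambda>x. V x powr p)"
  shows "(\<integral>x. (U x + V x) powr p \<partial>M) powr (1 / p)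
    \<le> (\<integral>x. U x powr p \<partial>M) powr (1 / p) + (\<integral>x. V x powr p \<partial>M) powr (1 / p)"
proof (rule field_le_epsilon)
  fix e :: real assume e: "0 < e"
  \<comment> \<open>The extra \<open>e / 2\<close> keeps \<open>a\<close> and \<open>b\<close>
    positive even when a norm is zero.\<close>
  define a where "a = (\<integral>x. U x powr p \<partial>M) powr (1 / p) + e / 2"
  define b where "b = (\<integral>x. V x powr p \<partial>M) powr (1 / p) + e / 2"
  have ab: "0 < a" "0 < b" using e by (auto simp: a_def b_def add_nonneg_pos)
  have Ua: "(\<integral>x. U x powr p \<partial>M) \<le> a powr p"
    using powr_mono2[of p "(\<integral>x. U x powr p \<partial>M) powr (1 / p)" a] p e powr_inverse_powr(1)[of "\<integral>x. U x powr p \<partial>M" p]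
    by (simp add: a_def)
  have Vb: "(\<integral>x. V x powr p \<partial>M) \<le> b powr p"
    using powr_mono2[of p "(\<integral>x. V x powr p \<partial>M) powr (1 / p)" b] p e powr_inverse_powr(1)[of "\<integral>x. V x powr p \<partial>M" p]
    by (simp add: b_def)
  have "(\<integral>x. (U x + V x) powr p \<partial>M)
      \<le> (\<integral>x. (a + b) powr (p - 1) * (a powr (1 - p) * U x powr p + b powr (1 - p) * V x powr p) \<partial>M)"
    using convex_powr_sum_le[OF p ab UV] int by (intro integral_mono') (auto intro!: mult_nonneg_nonneg add_nonneg_nonneg)
  also have "\<dots> = (a + b) powr (p - 1) *
      (a powr (1 - p) * (\<integral>x. U x powr p \<partial>M) + b powr (1 - p) * (\<integral>x. V x powr p \<partial>M))"
    using int by simp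
  also have "\<dots> \<le> (a + b) powr (p - 1) * (a powr (1 - p) * a powr p + b powr (1 - p) * b powr p)"
    using Ua Vb by (intro mult_left_mono add_mono) auto
  also have "\<dots> = (a + b) powr p"
    using ab by (simp add: powr_add[symmetric]) (simp add: powr_diff)
  finally have "(\<integral>x. (U x + V x) powr p \<partial>M) powr (1 / p) \<le> ((a + b) powr p) powr (1 / p)"
    using p by (intro powr_mono2) auto
  also have "\<dots> = a + b" using ab p by (intro powr_inverse_powr) auto
  finally show "(\<integral>x. (U x + V x) powr p \<partial>M) powr (1 / p)
    \<le> (\<integral>x. U x powr p \<partial>M) powr (1 / p) + (\<integral>x. V x powr p \<partial>M) powr (1 / p) + e"
    by (simp add: a_def b_def)
qed

section \<open>Strong measurability under restriction, differences and translations\<close>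

text \<open>Allows a function on \<open>S\<close> to be replaced by its extension by zero, so that
  the analysis can be done on the whole line. Simple functions on \<open>S\<close> extend by zero to
  simple functions, and restriction goes back.\<close>

lemma strongly_measurable_restrict_iff:
  assumes "S \<in> sets lebesgue"
  shows "strongly_measurable (lebesgue_on S) f \<longleftrightarrow> strongly_measurable lebesgue (\<lambda>x. indicator S x *\<^sub>R f x)"
proof
  assume "strongly_measurable (lebesgue_on S) f"
  then obtain s where s: "\<And>i::nat. simple_function (lebesgue_on S) (s i)"
    and lim: "AE x in lebesgue_on S. (\<lambda>i. s i x) \<longlonglongrightarrow> f x"
    unfolding strongly_measurable_def by blast
  have "AE x in lebesgue. (\<lambda>i. indicator S x *\<^sub>R s i x) \<longlonglongrightarrow> indicator S x *\<^sub>R f x"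
    using lim assms by (auto simp: AE_restrict_space_iff indicator_def elim!: eventually_mono)
  moreover have "simple_function lebesgue (\<lambda>x. indicator S x *\<^sub>R s i x)" for i
    using s[of i] assms by (simp add: simple_function_restrict_space)
  ultimately show "strongly_measurable lebesgue (\<lambda>x. indicator S x *\<^sub>R f x)"
    unfolding strongly_measurable_def by (intro exI[of _ "\<lambda>i x. indicator S x *\<^sub>R s i x"]) blast
next
  assume "strongly_measurable lebesgue (\<lambda>x. indicator S x *\<^sub>R f x)"
  then obtain s where s: "\<And>i::nat. simple_function lebesgue (s i)"
    and lim: "AE x in lebesgue. (\<lambda>i. s i x) \<longlonglongrightarrow> indicator S x *\<^sub>R f x"
    unfolding strongly_measurable_def by blast
  have "AE x in lebesgue_on S. (\<lambda>i. s i x) \<longlonglongrightarrow> f x"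
    using lim assms by (auto simp: AE_restrict_space_iff indicator_def elim!: eventually_mono)
  moreover have "simple_function (lebesgue_on S) (s i)" for i
  proof -
    have "simple_function lebesgue (\<lambda>x. indicat_real S x *\<^sub>R s i x)"
      using s assms by (intro simple_function_compose2[where h = "\<lambda>a b. a *\<^sub>R b"]) auto
    then show ?thesis using assms by (simp add: simple_function_restrict_space)
  qed
  ultimately show "strongly_measurable (lebesgue_on S) f"
    unfolding strongly_measurable_def by blast
qed

lemma strongly_measurable_diff:
  assumes "strongly_measurable M f" "strongly_measurable M g"
  shows "strongly_measurable M (\<lambda>x. f x - g x)"
proof -
  obtain s t where s: "\<And>i::nat. simple_function M (s i)" "AE x in M. (\<lambda>i. s i x) \<longlonglongrightarrow> f x"
    and t: "\<And>i::nat. simple_function M (t i)" "AE x in M. (\<lambda>i. t i x) \<longlonglongrightarrow> g x"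
    using assms unfolding strongly_measurable_def by blast
  have "AE x in M. (\<lambda>i. s i x - t i x) \<longlonglongrightarrow> f x - g x"
    using s(2) t(2) by eventually_elim (rule tendsto_diff)
  moreover have "simple_function M (\<lambda>x. s i x - t i x)" for i
    using s(1) t(1) by (rule simple_function_compose2)
  ultimately show ?thesis
    unfolding strongly_measurable_def by (intro exI[of _ "\<lambda>i x. s i x - t i x"]) auto
qed

lemma strongly_measurable_simple_function:
  "simple_function M f \<Longrightarrow> strongly_measurable M f"
  unfolding strongly_measurable_def by (intro exI[of _ "\<lambda>_. f"]) auto

lemma strongly_measurable_indicator:
  fixes f :: "real \<Rightarrow> 'a::real_normed_vector"
  assumes "strongly_measurable lebesgue f" "S \<in> sets lebesgue"
  shows "strongly_measurable lebesgue (\<lambda>x. indicator S x *\<^sub>R f x)"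
proof -
  obtain s where s: "\<And>i::nat. simple_function lebesgue (s i)" "AE x in lebesgue. (\<lambda>i. s i x) \<longlonglongrightarrow> f x"
    using assms(1) unfolding strongly_measurable_def by blast
  have "AE x in lebesgue. (\<lambda>i. indicator S x *\<^sub>R s i x) \<longlonglongrightarrow> indicator S x *\<^sub>R f x"
    using s(2) by eventually_elim (intro tendsto_intros)
  moreover have "simple_function lebesgue (\<lambda>x. indicat_real S x *\<^sub>R s i x)" for i
    using s assms by (intro simple_function_compose2[where h = "\<lambda>a b. a *\<^sub>R b"]) auto
  ultimately show ?thesis
    unfolding strongly_measurable_def by (intro exI[of _ "\<lambda>i x. indicator S x *\<^sub>R s i x"]) auto
qed

text \<open>Lebesgue measure is its own image under a translation.\<close>

lemma AE_lebesgue_shift: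
  fixes a :: real
  assumes "AE x in lebesgue. P x"
  shows "AE x in lebesgue. P (a + x)"
proof -
  have T: "(\<lambda>x. a + x) \<in> lebesgue \<rightarrow>\<^sub>M lebesgue"
    using lebesgue_affine_measurable[where c = "\<lambda>x::real. 1" and t = a] by simp
  have "lebesgue = distr lebesgue lebesgue (\<lambda>x. a + x)"
    using lebesgue_real_affine[of 1 a] by (simp add: density_1)
  then have "AE x in distr lebesgue lebesgue (\<lambda>x. a + x). P x" using assms by metis
  then show ?thesis by (rule AE_distrD[OF T])
qed

lemma strongly_measurable_shift:
  fixes a :: real
  assumes "strongly_measurable lebesgue f"
  shows "strongly_measurable lebesgue (\<lambda>x. f (a + x))"
proof -
  obtain s where s: "\<And>i::nat. simple_function lebesgue (s i)" "AE x in lebesgue. (\<lambda>i. s i x) \<longlonglongrightarrow> f x"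
    using assms(1) unfolding strongly_measurable_def by blast
  have T: "(\<lambda>x. a + x) \<in> lebesgue \<rightarrow>\<^sub>M lebesgue"
    using lebesgue_affine_measurable[where c = "\<lambda>x::real. 1" and t = a] by simp
  have "simple_function lebesgue (\<lambda>x. s i (a + x))" for i
    unfolding simple_function_def
  proof (intro conjI ballI)
    have "(\<lambda>x. s i (a + x)) ` space lebesgue \<subseteq> s i ` space lebesgue" by auto
    then show "finite ((\<lambda>x. s i (a + x)) ` space lebesgue)"
      using simple_functionD(1)[OF s(1)] by (rule finite_subset)
    fix y
    have "s i -` {y} \<inter> space lebesgue \<in> sets lebesgue" using simple_functionD(2)[OF s(1)] .
    from measurable_sets[OF T this] show "(\<lambda>x. s i (a + x)) -` {y} \<inter> space lebesgue \<in> sets lebesgue"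
      by (simp add: vimage_def)
  qed
  moreover note AE_lebesgue_shift[OF s(2), of a]
  ultimately show ?thesis
    unfolding strongly_measurable_def by (intro exI[of _ "\<lambda>i x. s i (a + x)"]) auto
qed

text \<open>The pointwise \<open>lim\<close> of the norms of the simple functions is measurable and
  agrees with the norm of \<open>f\<close> almost everywhere; completeness of Lebesgue measure
  transfers the measurability.\<close>

lemma borel_measurable_norm_strongly_measurable:
  fixes f :: "real \<Rightarrow> 'a::real_normed_vector"
  assumes "strongly_measurable lebesgue f"
  shows "(\<lambda>x. norm (f x)) \<in> borel_measurable lebesgue"
proof -
  obtain s where s: "\<And>i::nat. simple_function lebesgue (s i)" "AE x in lebesgue. (\<lambda>i. s i x) \<longlonglongrightarrow> f x"
    using assms(1) unfolding strongly_measurable_def by blast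
  have "(\<lambda>x. lim (\<lambda>i. norm (s i x))) \<in> borel_measurable lebesgue"
    by (intro borel_measurable_lim_metric borel_measurable_simple_function simple_function_compose1[OF s(1)])
  moreover have "AE x in lebesgue. lim (\<lambda>i. norm (s i x)) = norm (f x)"
    using s(2) by eventually_elim (auto intro!: limI tendsto_norm)
  ultimately show ?thesis by (rule borel_measurable_AE)
qed

subsection \<open>The seminorm on local Lebesgue spaces\<close>

text \<open>Measurability is demanded on the whole line and integrability only on \<open>A\<close>.
  Thus one measurability fact serves all windows and translates; functions on a half-line enter
  through their extension by zero.\<close>

definition Lp_on :: "real \<Rightarrow> real set \<Rightarrow> (real \<Rightarrow> 'a::banach) \<Rightarrow> bool" where
  "Lp_on p A f \<longleftrightarrow> strongly_measurable lebesgue f \<and> set_integrable lebesgue A (\<lambda>s. norm (f s) powr p)"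

lemma Lp_loc_UNIV_iff:
  "f \<in> Lp_loc p UNIV \<longleftrightarrow> strongly_measurable lebesgue f \<and> (\<forall>K. compact K \<longrightarrow> Lp_on p K f)"
  by (auto simp: Lp_loc_def Lp_on_def lebesgue_on_UNIV_eq)

lemma Lp_loc_UNIV_imp_Lp_on: "f \<in> Lp_loc p UNIV \<Longrightarrow> Lp_on p {a..b} f"
  by (simp add: Lp_loc_UNIV_iff)

lemma Lp_on_measurable:
  assumes "Lp_on p A f"
  shows "(\<lambda>s. norm (f s) powr p) \<in> borel_measurable lebesgue"
  using assms unfolding Lp_on_def
  by (intro powr_real_measurable borel_measurable_norm_strongly_measurable borel_measurable_const) auto

lemma indicator_scaleR_powr:
  fixes x p :: real
  assumes "1 \<le> p"
  shows "(indicator A s * x) powr p = indicator A s *\<^sub>R x powr p"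
  using assms by (auto simp: indicator_def)

lemma Lp_norm_nonneg [simp]: "0 \<le> Lp_norm p A f"
  by (simp add: Lp_norm_def)

lemma Lp_norm_powr:
  assumes "1 \<le> p"
  shows "Lp_norm p A f powr p = (LINT s:A|lebesgue. norm (f s) powr p)"
  unfolding Lp_norm_def set_lebesgue_integral_def
  using assms by (intro powr_inverse_powr integral_nonneg_AE) auto

lemma Lp_norm_le_iff:
  assumes "1 \<le> p" "0 \<le> e"
  shows "Lp_norm p A f \<le> e \<longleftrightarrow> (LINT s:A|lebesgue. norm (f s) powr p) \<le> e powr p"
  using assms powr_mono2[of p "Lp_norm p A f" e] powr_less_mono2[of p e "Lp_norm p A f"]
  by (auto simp: Lp_norm_powr[symmetric] not_le[symmetric])

text \<open>Passes between the integrals in the definition of \<open>SpAA\<close> and the seminorm,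
  for which the triangle inequality is available.\<close>

lemma Lp_norm_tendsto_0_iff:
  assumes "1 \<le> p"
  shows "(\<lambda>k. LINT s:A|lebesgue. norm (f k s) powr p) \<longlonglongrightarrow> 0 \<longleftrightarrow> (\<lambda>k. Lp_norm p A (f k)) \<longlonglongrightarrow> 0"
proof
  assume "(\<lambda>k. LINT s:A|lebesgue. norm (f k s) powr p) \<longlonglongrightarrow> 0"
  from tendsto_powr2[OF this, of "\<lambda>_. 1 / p" "1 / p"] assms
  show "(\<lambda>k. Lp_norm p A (f k)) \<longlonglongrightarrow> 0"
    by (simp add: Lp_norm_def set_lebesgue_integral_def integral_nonneg_AE)
next
  assume "(\<lambda>k. Lp_norm p A (f k)) \<longlonglongrightarrow> 0"
  from tendsto_powr2[OF this, of "\<lambda>_. p" p] assms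
  show "(\<lambda>k. LINT s:A|lebesgue. norm (f k s) powr p) \<longlonglongrightarrow> 0"
    by (simp add: Lp_norm_powr)
qed

lemma Lp_norm_cong: "(\<And>s. s \<in> A \<Longrightarrow> norm (f s) = norm (g s)) \<Longrightarrow> Lp_norm p A f = Lp_norm p A g"
  unfolding Lp_norm_def set_lebesgue_integral_def
  by (intro arg_cong[where f = "\<lambda>x. x powr _"] Bochner_Integration.integral_cong) (auto simp: indicator_def)

lemma Lp_norm_minus_commute: "Lp_norm p A (\<lambda>s. f s - g s) = Lp_norm p A (\<lambda>s. g s - f s)"
  by (rule Lp_norm_cong) (rule norm_minus_commute)

text \<open>Minkowski's inequality in terms of a pointwise bound by two norms, which covers
  differences, perturbations and the splitting of an interval at once.\<close>

lemma Lp_norm_le_add: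
  assumes p: "1 \<le> p" and g: "Lp_on p A g" and h: "Lp_on p A h"
    and le: "\<And>s. s \<in> A \<Longrightarrow> norm (f s) \<le> norm (g s) + norm (h s)"
  shows "Lp_norm p A f \<le> Lp_norm p A g + Lp_norm p A h"
proof -
  let ?U = "\<lambda>s. indicat_real A s * norm (g s)" and ?V = "\<lambda>s. indicat_real A s * norm (h s)"
  have U: "integrable lebesgue (\<lambda>s. ?U s powr p)" "(\<integral>s. ?U s powr p \<partial>lebesgue) powr (1 / p) = Lp_norm p A g"
    using g unfolding Lp_on_def set_integrable_def Lp_norm_def set_lebesgue_integral_def
    by (auto simp: indicator_scaleR_powr[OF p])
  have V: "integrable lebesgue (\<lambda>s. ?V s powr p)" "(\<integral>s. ?V s powr p \<partial>lebesgue) powr (1 / p) = Lp_norm p A h"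
    using h unfolding Lp_on_def set_integrable_def Lp_norm_def set_lebesgue_integral_def
    by (auto simp: indicator_scaleR_powr[OF p])
  have int: "integrable lebesgue (\<lambda>s. (?U s + ?V s) powr p)"
  proof (rule Bochner_Integration.integrable_bound)
    show "integrable lebesgue (\<lambda>s. 2 powr (p - 1) * (?U s powr p + ?V s powr p))"
      using U(1) V(1) by simp
    \<comment> \<open>Integrability gives measurability of the \<open>p\<close>-th powers only, so
      \<open>?U\<close> and \<open>?V\<close> are recovered as their \<open>p\<close>-th
      roots.\<close>
    have "g' \<in> borel_measurable lebesgue \<Longrightarrow> h' \<in> borel_measurable lebesgue \<Longrightarrow>
      (\<lambda>s. (g' s powr (1 / p) + h' s powr (1 / p)) powr p) \<in> borel_measurable lebesgue" for g' h' :: "real \<Rightarrow> real"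
      by (intro powr_real_measurable borel_measurable_add borel_measurable_const)
    from this[OF borel_measurable_integrable[OF U(1)] borel_measurable_integrable[OF V(1)]]
    show "(\<lambda>s. (?U s + ?V s) powr p) \<in> borel_measurable lebesgue"
      using p by (simp add: powr_inverse_powr)
    show "AE s in lebesgue. norm ((?U s + ?V s) powr p) \<le> norm (2 powr (p - 1) * (?U s powr p + ?V s powr p))"
      using powr_sum_le[OF p] by (intro AE_I2) auto
  qed
  have "(\<integral>s. indicator A s *\<^sub>R norm (f s) powr p \<partial>lebesgue) \<le> (\<integral>s. (?U s + ?V s) powr p \<partial>lebesgue)"
    using int by (rule integral_mono') (use p le in \<open>auto simp: indicator_def intro!: powr_mono2\<close>)
  then have "Lp_norm p A f \<le> (\<integral>s. (?U s + ?V s) powr p \<partial>lebesgue) powr (1 / p)"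
    unfolding Lp_norm_def set_lebesgue_integral_def using p by (intro powr_mono2 integral_nonneg_AE) auto
  also have "\<dots> \<le> Lp_norm p A g + Lp_norm p A h"
    unfolding U(2)[symmetric] V(2)[symmetric] using U V by (intro minkowski_real[OF p]) auto
  finally show ?thesis .
qed

lemma Lp_on_bound:
  assumes p: "1 \<le> p" and f: "strongly_measurable lebesgue f" and A: "A \<in> sets lebesgue"
    and g: "set_integrable lebesgue A g" and le: "\<And>s. s \<in> A \<Longrightarrow> norm (f s) powr p \<le> g s"
  shows "Lp_on p A f"
  unfolding Lp_on_def set_integrable_def
proof
  have "(\<lambda>s. norm (f s)) \<in> borel_measurable lebesgue"
    using f by (rule borel_measurable_norm_strongly_measurable)
  then have m: "(\<lambda>s. indicator A s *\<^sub>R norm (f s) powr p) \<in> borel_measurable lebesgue"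
    using A by measurable
  show "integrable lebesgue (\<lambda>s. indicator A s *\<^sub>R norm (f s) powr p)"
    using g[unfolded set_integrable_def] m
  proof (rule Bochner_Integration.integrable_bound)
    show "AE s in lebesgue. norm (indicator A s *\<^sub>R norm (f s) powr p) \<le> norm (indicator A s *\<^sub>R g s)"
      using le by (intro AE_I2) (auto simp: indicator_def intro: order_trans[OF _ abs_ge_self])
  qed
qed (rule f)

lemma Lp_on_diff:
  assumes p: "1 \<le> p" and A: "A \<in> sets lebesgue" and f: "Lp_on p A f" and g: "Lp_on p A g"
  shows "Lp_on p A (\<lambda>s. f s - g s)"
proof (rule Lp_on_bound[OF p _ A])
  show "strongly_measurable lebesgue (\<lambda>s. f s - g s)"
    using f g by (auto simp: Lp_on_def intro: strongly_measurable_diff)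
  show "set_integrable lebesgue A (\<lambda>s. 2 powr (p - 1) * (norm (f s) powr p + norm (g s) powr p))"
    using f g unfolding Lp_on_def by (intro set_integrable_mult_right set_integral_add) auto
  show "norm (f s - g s) powr p \<le> 2 powr (p - 1) * (norm (f s) powr p + norm (g s) powr p)" for s
  proof -
    have "norm (f s - g s) powr p \<le> (norm (f s) + norm (g s)) powr p"
      using p by (intro powr_mono2 norm_triangle_ineq4) auto
    also have "\<dots> \<le> 2 powr (p - 1) * (norm (f s) powr p + norm (g s) powr p)"
      by (rule powr_sum_le[OF p]) auto
    finally show ?thesis .
  qed
qed

lemma Lp_on_subset:
  assumes "Lp_on p B f" "A \<in> sets lebesgue" "A \<subseteq> B"
  shows "Lp_on p A f"
  using assms set_integrable_subset unfolding Lp_on_def by blast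

lemma Lp_norm_mono_set:
  assumes "1 \<le> p" "Lp_on p B f" "A \<subseteq> B"
  shows "Lp_norm p A f \<le> Lp_norm p B f"
  unfolding Lp_norm_def set_lebesgue_integral_def
  using assms by (intro powr_mono2 integral_mono' integral_nonneg_AE)
    (auto simp: Lp_on_def set_integrable_def indicator_def)

lemma Lp_norm_shift: "Lp_norm p {c..d} (\<lambda>s. f (a + s)) = Lp_norm p {a + c..a + d} f"
proof -
  have "indicator {c..d} s = (indicator {a + c..a + d} (a + s) :: real)" for s
    by (auto simp: indicator_def)
  then show ?thesis
    using lebesgue_integral_real_affine[of 1 "\<lambda>s. indicator {a + c..a + d} s *\<^sub>R norm (f s) powr p" a]
    by (simp add: Lp_norm_def set_lebesgue_integral_def)
qed

lemma Lp_on_shift: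
  assumes "Lp_on p {a + c..a + d} f"
  shows "Lp_on p {c..d} (\<lambda>s. f (a + s))"
proof -
  have "indicator {c..d} s = (indicator {a + c..a + d} (a + s) :: real)" for s
    by (auto simp: indicator_def)
  then show ?thesis
    using assms lebesgue_integrable_real_affine_iff[of 1 "\<lambda>s. indicator {a + c..a + d} s *\<^sub>R norm (f s) powr p" a]
    by (auto simp: Lp_on_def set_integrable_def intro: strongly_measurable_shift)
qed

lemma Lp_loc_UNIV_I:
  assumes "strongly_measurable lebesgue f" "\<And>a b. Lp_on p {a..b} f"
  shows "f \<in> Lp_loc p UNIV"
  unfolding Lp_loc_UNIV_iff
proof (intro conjI allI impI)
  fix K :: "real set" assume K: "compact K"
  then obtain a b where "K \<subseteq> {a..b}"
    using bounded_subset_cbox_symmetric[OF compact_imp_bounded[OF K]] by (metis cbox_interval)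
  with K show "Lp_on p K f"
    using assms(2)[of a b] by (auto intro: Lp_on_subset simp: compact_imp_closed borel_closed)
qed (rule assms(1))

lemma Lp_loc_UNIV_diff:
  assumes "1 \<le> p" "f \<in> Lp_loc p UNIV" "g \<in> Lp_loc p UNIV"
  shows "(\<lambda>s. f s - g s) \<in> Lp_loc p UNIV"
  using assms by (intro Lp_loc_UNIV_I strongly_measurable_diff Lp_on_diff) (auto simp: Lp_loc_UNIV_iff)

lemma Lp_loc_UNIV_shift: "f \<in> Lp_loc p UNIV \<Longrightarrow> (\<lambda>s. f (a + s)) \<in> Lp_loc p UNIV"
  by (intro Lp_loc_UNIV_I strongly_measurable_shift Lp_on_shift) (auto simp: Lp_loc_UNIV_iff)

lemma Lp_norm_diff_triangle:
  assumes "1 \<le> p" "f \<in> Lp_loc p UNIV" "g \<in> Lp_loc p UNIV" "h \<in> Lp_loc p UNIV"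
  shows "Lp_norm p {a..b} (\<lambda>s. f s - h s)
    \<le> Lp_norm p {a..b} (\<lambda>s. f s - g s) + Lp_norm p {a..b} (\<lambda>s. g s - h s)"
  using assms
  by (intro Lp_norm_le_add Lp_loc_UNIV_imp_Lp_on Lp_loc_UNIV_diff) (auto intro: norm_triangle_le norm_diff_triangle_le)

lemma set_integrable_const_Icc: "set_integrable lebesgue {a..b} (\<lambda>_. c :: real)" for a b :: real
  unfolding set_integrable_def by (simp add: emeasure_lborel_Icc_eq)

lemma Lp_norm_le_const:
  assumes p: "1 \<le> p" and "0 \<le> e" "a \<le> b" and le: "\<And>s. s \<in> {a..b} \<Longrightarrow> norm (f s) \<le> e"
  shows "Lp_norm p {a..b} f \<le> (b - a) powr (1 / p) * e"
proof -
  have "(LINT s:{a..b}|lebesgue. norm (f s) powr p) \<le> (LINT s:{a..b}|lebesgue. e powr p)"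
    unfolding set_lebesgue_integral_def using assms set_integrable_const_Icc[unfolded set_integrable_def]
    by (intro integral_mono') (auto simp: indicator_def intro!: powr_mono2)
  also have "\<dots> = (b - a) * e powr p" using assms by (simp add: set_lebesgue_integral_def)
  also have "\<dots> = ((b - a) powr (1 / p) * e) powr p"
    using assms by (simp add: powr_mult powr_inverse_powr)
  finally show ?thesis using assms by (simp add: Lp_norm_le_iff)
qed

subsection \<open>Density and continuity of translations\<close>

lemma Lp_norm_dominated_convergence:
  assumes p: "1 \<le> p" and A: "A \<in> sets lebesgue" and f: "\<And>k. strongly_measurable lebesgue (f k)"
    and w: "set_integrable lebesgue A w" and le: "\<And>k s. s \<in> A \<Longrightarrow> norm (f k s) powr p \<le> w s"
    and lim: "AE s in lebesgue. (\<lambda>k. f k s) \<longlonglongrightarrow> 0"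
  shows "(\<lambda>k. Lp_norm p A (f k)) \<longlonglongrightarrow> 0"
proof -
  have "(\<lambda>k. \<integral>s. indicator A s *\<^sub>R norm (f k s) powr p \<partial>lebesgue) \<longlonglongrightarrow> (\<integral>s. 0 \<partial>(lebesgue :: real measure))"
  proof (rule Bochner_Integration.integral_dominated_convergence)
    show "integrable lebesgue (\<lambda>s. indicator A s *\<^sub>R w s)" using w by (simp add: set_integrable_def)
    show "(\<lambda>s. indicator A s *\<^sub>R norm (f k s) powr p) \<in> borel_measurable lebesgue" for k
      using A borel_measurable_norm_strongly_measurable[OF f]
      by (intro borel_measurable_scaleR borel_measurable_indicator powr_real_measurable borel_measurable_const)
    show "AE s in lebesgue. norm (indicator A s *\<^sub>R norm (f k s) powr p) \<le> indicator A s *\<^sub>R w s" for k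
      using le by (intro AE_I2) (auto simp: indicator_def)
    show "AE s in lebesgue. (\<lambda>k. indicator A s *\<^sub>R norm (f k s) powr p) \<longlonglongrightarrow> 0"
      using lim
    proof eventually_elim
      case (elim s)
      from tendsto_powr2[OF tendsto_norm[OF this], of "\<lambda>_. p" p] p
      have "(\<lambda>k. norm (f k s) powr p) \<longlonglongrightarrow> 0" by simp
      from tendsto_scaleR[OF tendsto_const this] show ?case by simp
    qed
  qed simp
  then show ?thesis
    unfolding Lp_norm_tendsto_0_iff[OF p, symmetric] set_lebesgue_integral_def by simp
qed

text \<open>Strong measurability supplies simple functions converging almost everywhere. After
  truncation they are dominated in terms of \<open>f\<close>, and dominated convergence
  applies.\<close>

lemma simple_function_Lp_dense:
  fixes f :: "real \<Rightarrow> 'a::banach"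
  assumes p: "1 \<le> p" and A: "A \<in> sets lebesgue" and f: "Lp_on p A f" and e: "0 < e"
  obtains s where "simple_function lebesgue s" "Lp_norm p A (\<lambda>x. f x - s x) < e"
proof -
  obtain s where s: "\<And>i::nat. simple_function lebesgue (s i)" "AE x in lebesgue. (\<lambda>i. s i x) \<longlonglongrightarrow> f x"
    using f unfolding Lp_on_def strongly_measurable_def by blast
  have nf: "(\<lambda>x. norm (f x)) \<in> borel_measurable lebesgue"
    using f by (intro borel_measurable_norm_strongly_measurable) (auto simp: Lp_on_def)
  \<comment> \<open>The truncation gives the majorant \<open>3 * norm (f x)\<close> for the error.
    It is eventually inactive where \<open>f x\<close> is nonzero, and where \<open>f x = 0\<close>
    it makes \<open>t i x\<close> exactly zero.\<close>
  define t where "t = (\<lambda>i x. if norm (s i x) \<le> 2 * norm (f x) then s i x else 0)"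
  have t: "simple_function lebesgue (t i)" for i
  proof -
    have "(\<lambda>x. norm (s i x)) \<in> borel_measurable lebesgue"
      by (intro borel_measurable_simple_function simple_function_compose1[OF s(1)])
    then have "{x \<in> space lebesgue. norm (s i x) \<le> 2 * norm (f x)} \<in> sets lebesgue"
      using nf by (intro borel_measurable_le borel_measurable_times borel_measurable_const) auto
    then show ?thesis
      unfolding t_def using s(1) by (intro simple_function_If) auto
  qed
  have le: "norm (f x - t i x) \<le> 3 * norm (f x)" for i x
    using norm_triangle_ineq4[of "f x" "t i x"] by (auto simp: t_def)
  have "(\<lambda>i. Lp_norm p A (\<lambda>x. f x - t i x)) \<longlonglongrightarrow> 0"
  proof (rule Lp_norm_dominated_convergence[OF p A])
    show "strongly_measurable lebesgue (\<lambda>x. f x - t i x)" for i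
      using f by (auto simp: Lp_on_def intro: strongly_measurable_diff strongly_measurable_simple_function t)
    show "set_integrable lebesgue A (\<lambda>x. 3 powr p * norm (f x) powr p)"
      using f by (auto simp: Lp_on_def)
    show "norm (f x - t i x) powr p \<le> 3 powr p * norm (f x) powr p" for i x
      using powr_mono2[OF _ _ le[of x i], of p] p by (simp add: powr_mult)
    show "AE x in lebesgue. (\<lambda>i. f x - t i x) \<longlonglongrightarrow> 0"
      using s(2)
    proof eventually_elim
      case (elim x)
      have "(\<lambda>i. t i x) \<longlonglongrightarrow> f x"
      proof (cases "f x = 0")
        case True
        then have "t i x = 0" for i by (auto simp: t_def)
        with True show ?thesis by simp
      next
        case False
        then have "norm (f x) < 2 * norm (f x)" by simp
        from order_tendstoD(2)[OF tendsto_norm[OF elim] this]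
        have "eventually (\<lambda>i. s i x = t i x) sequentially" by eventually_elim (simp add: t_def)
        with elim show ?thesis by (rule Lim_transform_eventually)
      qed
      from tendsto_diff[OF tendsto_const[of "f x"] this] show ?case by simp
    qed
  qed
  from order_tendstoD(2)[OF this e] obtain i where "Lp_norm p A (\<lambda>x. f x - t i x) < e"
    by (auto simp: eventually_sequentially)
  with t that show ?thesis by blast
qed

lemma strongly_measurable_scaleR_left:
  fixes \<phi> :: "real \<Rightarrow> real"
  assumes "\<phi> \<in> borel_measurable lebesgue"
  shows "strongly_measurable lebesgue (\<lambda>x. \<phi> x *\<^sub>R y)"
proof -
  obtain F where F: "\<And>i. simple_function lebesgue (F i)" "\<And>x. (\<lambda>i. F i x) \<longlonglongrightarrow> \<phi> x"
    using borel_measurable_implies_sequence_metric[OF assms, of 0] by auto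
  show ?thesis unfolding strongly_measurable_def
    by (intro exI[of _ "\<lambda>i x. F i x *\<^sub>R y"] conjI allI simple_function_compose1[OF F(1)] AE_I2
        tendsto_scaleR[OF F(2) tendsto_const])
qed

lemma strongly_measurable_sum:
  assumes "finite Y" "\<And>y. y \<in> Y \<Longrightarrow> strongly_measurable M (f y)"
  shows "strongly_measurable M (\<lambda>x. \<Sum>y\<in>Y. f y x)"
  using assms
proof (induction Y)
  case empty
  show ?case by (simp add: strongly_measurable_simple_function)
next
  case (insert y Y)
  have "strongly_measurable M (\<lambda>x. f y x - (0 - (\<Sum>y\<in>Y. f y x)))"
    using insert by (intro strongly_measurable_diff) (auto simp: strongly_measurable_simple_function)
  with insert(1,2) show ?case by simp
qed

text \<open>The library notion \<open>measurable_on\<close> yields continuous functions converging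
  off a negligible set; clamping them to [0,1] preserves the limit and adds the uniform bound needed
  for dominated convergence.\<close>

lemma indicator_limit_of_continuous:
  fixes B :: "real set"
  assumes "B \<in> sets lebesgue"
  obtains g :: "nat \<Rightarrow> real \<Rightarrow> real" where "\<And>n. continuous_on UNIV (g n)" "\<And>n x. \<bar>g n x\<bar> \<le> 1"
    "AE x in lebesgue. (\<lambda>n. g n x) \<longlonglongrightarrow> indicator B x"
proof -
  have "(indicator B :: real \<Rightarrow> real) measurable_on UNIV"
    using assms by (intro lebesgue_measurable_imp_measurable_on) auto
  then obtain N g where N: "negligible N" and g: "\<And>n. continuous_on UNIV (g n)"
    and lim: "\<And>x. x \<notin> N \<Longrightarrow> (\<lambda>n. g n x) \<longlonglongrightarrow> indicat_real B x"
    unfolding measurable_on_def by auto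
  define h where "h = (\<lambda>n x. max 0 (min 1 (g n x)))"
  have "continuous_on UNIV (h n)" for n
    unfolding h_def by (intro continuous_intros g)
  moreover have "\<bar>h n x\<bar> \<le> 1" for n x by (auto simp: h_def)
  moreover have "(\<lambda>n. h n x) \<longlonglongrightarrow> indicator B x" if "x \<notin> N" for x
  proof -
    have "(\<lambda>n. h n x) \<longlonglongrightarrow> max 0 (min 1 (indicator B x))"
      unfolding h_def by (intro tendsto_intros lim that)
    then show ?thesis by (simp add: indicator_def split: if_splits)
  qed
  then have "AE x in lebesgue. (\<lambda>n. h n x) \<longlonglongrightarrow> indicator B x"
    using N by (intro AE_I'[of N]) (auto simp: negligible_iff_null_sets)
  ultimately show ?thesis using that by blast
qed

text \<open>A simple function is a finite sum of its values times indicators of its level sets. Each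
  indicator is replaced by a continuous approximation; all functions involved are bounded by
  \<open>R\<close>, the sum of the norms of the values, and constants are integrable on the bounded
  interval.\<close>

lemma continuous_Lp_dense_simple:
  fixes s :: "real \<Rightarrow> 'a::banach"
  assumes p: "1 \<le> p" and s: "simple_function lebesgue s" and e: "0 < e"
  obtains c where "continuous_on UNIV c" "strongly_measurable lebesgue c"
    "Lp_on p {a..b} (\<lambda>x. s x - c x)" "Lp_norm p {a..b} (\<lambda>x. s x - c x) < e"
proof -
  let ?Y = "range s"
  have fin: "finite ?Y" using simple_functionD(1)[OF s] by simp
  have B: "s -` {y} \<in> sets lebesgue" for y using simple_functionD(2)[OF s, of "{y}"] by simp
  have "\<exists>g :: nat \<Rightarrow> real \<Rightarrow> real. (\<forall>n. continuous_on UNIV (g n)) \<and> (\<forall>n x. \<bar>g n x\<bar> \<le> 1) \<and>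
    (AE x in lebesgue. (\<lambda>n. g n x) \<longlonglongrightarrow> indicator (s -` {y}) x)" for y
    using indicator_limit_of_continuous[OF B[of y]] by metis
  then obtain g where g: "\<And>y n. continuous_on UNIV (g y n :: real \<Rightarrow> real)" "\<And>y n x. \<bar>g y n x\<bar> \<le> 1"
    "\<And>y. AE x in lebesgue. (\<lambda>n. g y n x) \<longlonglongrightarrow> indicator (s -` {y}) x"
    by metis
  define c where "c = (\<lambda>n x. \<Sum>y\<in>?Y. g y n x *\<^sub>R y)"
  have c: "continuous_on UNIV (c n)" "strongly_measurable lebesgue (c n)" for n
  proof -
    show "continuous_on UNIV (c n)" unfolding c_def by (intro continuous_intros g)
    have "g y n \<in> borel_measurable lebesgue" for y
      using borel_measurable_continuous_onI[OF g(1)] by (intro measurable_completion) simp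
    then show "strongly_measurable lebesgue (c n)"
      unfolding c_def by (intro strongly_measurable_sum fin strongly_measurable_scaleR_left)
  qed
  define R where "R = (\<Sum>y\<in>?Y. norm y)"
  have "norm (c n x) \<le> R" for n x
    unfolding c_def R_def using g(2) by (intro sum_norm_le) (auto intro!: mult_left_le_one_le)
  moreover have "norm (s x) \<le> R" for x
    unfolding R_def using fin by (intro member_le_sum) auto
  ultimately have le: "norm (s x - c n x) \<le> 2 * R" for x n
    using norm_triangle_ineq4[of "s x" "c n x"] by (metis add_mono mult_2 order_trans)
  have meas: "strongly_measurable lebesgue (\<lambda>x. s x - c n x)" for n
    by (intro strongly_measurable_diff strongly_measurable_simple_function[OF s] c)
  have "AE x in lebesgue. \<forall>y\<in>?Y. (\<lambda>n. g y n x) \<longlonglongrightarrow> indicator (s -` {y}) x"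
    by (intro AE_finite_allI fin g(3))
  then have lim: "AE x in lebesgue. (\<lambda>n. s x - c n x) \<longlonglongrightarrow> 0"
  proof eventually_elim
    case (elim x)
    then have "(\<lambda>n. c n x) \<longlonglongrightarrow> (\<Sum>y\<in>?Y. indicator (s -` {y}) x *\<^sub>R y)"
      unfolding c_def by (intro tendsto_sum tendsto_scaleR tendsto_const) auto
    also have "(\<Sum>y\<in>?Y. indicat_real (s -` {y}) x *\<^sub>R y) = (\<Sum>y\<in>?Y. if y = s x then s x else 0)"
      by (intro sum.cong) (auto simp: indicator_def)
    also have "\<dots> = s x" using fin by (simp add: sum.delta)
    finally show ?case using tendsto_diff[OF tendsto_const[of "s x"]] by fastforce
  qed
  have bd: "norm (s x - c n x) powr p \<le> (2 * R) powr p" for x n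
    using le p by (intro powr_mono2) auto
  have "(\<lambda>n. Lp_norm p {a..b} (\<lambda>x. s x - c n x)) \<longlonglongrightarrow> 0"
    by (rule Lp_norm_dominated_convergence[OF p _ meas set_integrable_const_Icc bd lim]) auto
  from order_tendstoD(2)[OF this e] obtain n where "Lp_norm p {a..b} (\<lambda>x. s x - c n x) < e"
    by (auto simp: eventually_sequentially)
  moreover have "Lp_on p {a..b} (\<lambda>x. s x - c n x)"
    by (rule Lp_on_bound[OF p meas _ set_integrable_const_Icc bd]) auto
  ultimately show ?thesis using c that by blast
qed

lemma simple_function_Lp_on:
  fixes s :: "real \<Rightarrow> 'a::banach"
  assumes p: "1 \<le> p" and s: "simple_function lebesgue s"
  shows "Lp_on p {a..b} s"
proof (rule Lp_on_bound[OF p strongly_measurable_simple_function[OF s] _ set_integrable_const_Icc])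
  have fin: "finite (range s)" using simple_functionD(1)[OF s] by simp
  show "norm (s x) powr p \<le> (\<Sum>y\<in>range s. norm y) powr p" for x
    using p fin by (intro powr_mono2 member_le_sum) auto
qed auto

lemma simple_function_Lp_loc:
  "1 \<le> p \<Longrightarrow> simple_function lebesgue s \<Longrightarrow> s \<in> Lp_loc p UNIV"
  by (intro Lp_loc_UNIV_I strongly_measurable_simple_function simple_function_Lp_on)

lemma continuous_Lp_dense:
  fixes f :: "real \<Rightarrow> 'a::banach"
  assumes p: "1 \<le> p" and f: "Lp_on p {a..b} f" and e: "0 < e"
  obtains c where "continuous_on UNIV c" "Lp_on p {a..b} (\<lambda>x. f x - c x)"
    "Lp_norm p {a..b} (\<lambda>x. f x - c x) < e"
proof -
  obtain s where s: "simple_function lebesgue s" "Lp_norm p {a..b} (\<lambda>x. f x - s x) < e / 2"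
    using simple_function_Lp_dense[OF p _ f, of "e / 2"] e by auto
  obtain c where c: "continuous_on UNIV c" "strongly_measurable lebesgue c"
    "Lp_on p {a..b} (\<lambda>x. s x - c x)" "Lp_norm p {a..b} (\<lambda>x. s x - c x) < e / 2"
    using continuous_Lp_dense_simple[OF p s(1), of "e / 2" a b] e by auto
  have fs: "Lp_on p {a..b} (\<lambda>x. f x - s x)"
    by (rule Lp_on_diff[OF p _ f simple_function_Lp_on[OF p s(1)]]) simp
  have "Lp_on p {a..b} (\<lambda>x. (f x - s x) - (0 - (s x - c x)))"
    using Lp_on_diff[OF p _ fs Lp_on_diff[OF p _ simple_function_Lp_on[OF p, of "\<lambda>_. 0"] c(3)]] by simp
  moreover have "Lp_norm p {a..b} (\<lambda>x. f x - c x)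
      \<le> Lp_norm p {a..b} (\<lambda>x. f x - s x) + Lp_norm p {a..b} (\<lambda>x. s x - c x)"
    using fs c(3) by (intro Lp_norm_le_add p) (auto intro: norm_diff_triangle_le)
  ultimately show ?thesis using s(2) c that by fastforce
qed

text \<open>The classical argument: approximate \<open>f\<close> by a continuous \<open>c\<close>
  near the window, translate \<open>c\<close> using uniform continuity on a compact interval, and
  estimate the two translated errors \<open>f - c\<close> by the norm on the larger
  interval.\<close>

lemma Lp_translation_continuous:
  fixes f :: "real \<Rightarrow> 'a::banach"
  assumes p: "1 \<le> p" and f: "f \<in> Lp_loc p UNIV"
  shows "((\<lambda>h. Lp_norm p {0..1} (\<lambda>s. f (h + s) - f (t + s))) \<longlongrightarrow> 0) (at t)"
proof (rule tendstoI)
  fix e :: real assume e: "0 < e"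
  \<comment> \<open>The interval contains every window from \<open>h\<close> to \<open>h + 1\<close>
    with \<open>h\<close> at distance less than 1 from \<open>t\<close>.\<close>
  obtain c where c: "continuous_on UNIV c" and fc: "Lp_on p {t - 1..t + 2} (\<lambda>x. f x - c x)"
    and less: "Lp_norm p {t - 1..t + 2} (\<lambda>x. f x - c x) < e / 4"
    using continuous_Lp_dense[OF p Lp_loc_UNIV_imp_Lp_on[OF f], of "e / 4"] e by auto
  have "uniformly_continuous_on {t - 1..t + 2} c"
    using c by (intro compact_uniformly_continuous) (auto intro: continuous_on_subset)
  then obtain d where d: "0 < d" and dd: "\<And>x y. x \<in> {t - 1..t + 2} \<Longrightarrow> y \<in> {t - 1..t + 2} \<Longrightarrow> dist x y < d \<Longrightarrow> dist (c x) (c y) < e / 4"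
    unfolding uniformly_continuous_on_def using e by (metis dist_commute zero_less_divide_iff zero_less_numeral)
  have "Lp_norm p {0..1} (\<lambda>s. f (h + s) - f (t + s)) < e" if h: "dist h t < min d 1" for h
  proof -
    define F where "F = (\<lambda>x. f x - c x)"
    have sh: "Lp_on p {0..1} (\<lambda>s. F (u + s))" "Lp_norm p {0..1} (\<lambda>s. F (u + s)) < e / 4"
      if u: "dist u t < 1" for u
    proof -
      have sub: "{u + 0..u + 1} \<subseteq> {t - 1..t + 2}" using u by (auto simp: dist_real_def)
      show "Lp_on p {0..1} (\<lambda>s. F (u + s))"
        using fc sub unfolding F_def[symmetric] by (intro Lp_on_shift) (auto intro: Lp_on_subset)
      show "Lp_norm p {0..1} (\<lambda>s. F (u + s)) < e / 4"
        using Lp_norm_mono_set[OF p fc sub] less unfolding Lp_norm_shift[of p 0 1 F u] by (simp add: F_def)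
    qed
    have F1: "Lp_on p {0..1} (\<lambda>s. F (h + s) - F (t + s))"
      using h by (intro Lp_on_diff sh p) auto
    have "Lp_norm p {0..1} (\<lambda>s. F (h + s) - F (t + s)) \<le> Lp_norm p {0..1} (\<lambda>s. F (h + s)) + Lp_norm p {0..1} (\<lambda>s. F (t + s))"
      using h by (intro Lp_norm_le_add sh p norm_triangle_ineq4) auto
    also have "\<dots> < e / 4 + e / 4" using h by (intro add_strict_mono sh) auto
    finally have 1: "Lp_norm p {0..1} (\<lambda>s. F (h + s) - F (t + s)) < e / 2" by simp
    have "norm (c (h + s) - c (t + s)) \<le> e / 4" if "s \<in> {0..1}" for s
      using dd[of "h + s" "t + s"] that h by (auto simp: dist_real_def dist_norm abs_less_iff)
    then have le: "norm (f (h + s) - f (t + s)) \<le> norm (F (h + s) - F (t + s)) + norm (e / 4)" if "s \<in> {0..1}" for s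
      using norm_triangle_ineq[of "F (h + s) - F (t + s)" "c (h + s) - c (t + s)"] that e
      by (fastforce simp: F_def algebra_simps)
    have "Lp_norm p {0..1} (\<lambda>s. f (h + s) - f (t + s)) \<le>
       Lp_norm p {0..1} (\<lambda>s. F (h + s) - F (t + s)) + Lp_norm p {0..1} (\<lambda>s. e / 4)"
      by (rule Lp_norm_le_add[OF p F1 simple_function_Lp_on[OF p] le]) auto
    also have "Lp_norm p {0..1} (\<lambda>s. e / 4) \<le> e / 4"
      using Lp_norm_le_const[OF p, of "e / 4" 0 1 "\<lambda>_. e / 4"] e by simp
    finally show ?thesis using 1 e by simp
  qed
  then show "\<forall>\<^sub>F h in at t. dist (Lp_norm p {0..1} (\<lambda>s. f (h + s) - f (t + s))) 0 < e"
    unfolding eventually_at using d by (intro exI[of _ "min d 1"]) auto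
qed

subsection \<open>Completeness\<close>

lemma Lp_on_indicator:
  assumes "Lp_on p B f" "A \<in> sets lebesgue" "B \<in> sets lebesgue" "B \<subseteq> A"
  shows "Lp_on p A (\<lambda>s. indicator B s *\<^sub>R f s)"
proof -
  have "indicator A s *\<^sub>R norm (indicator B s *\<^sub>R f s) powr p = (indicator B s *\<^sub>R norm (f s) powr p :: real)" for s
    using assms(4) by (auto simp: indicator_def)
  then show ?thesis
    using assms by (simp add: Lp_on_def set_integrable_def strongly_measurable_indicator)
qed

lemma Lp_norm_indicator:
  assumes "B \<subseteq> A"
  shows "Lp_norm p A (\<lambda>s. indicator B s *\<^sub>R f s) = Lp_norm p B f"
proof -
  have "indicator A s *\<^sub>R norm (indicator B s *\<^sub>R f s) powr p = (indicator B s *\<^sub>R norm (f s) powr p :: real)" for s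
    using assms by (auto simp: indicator_def)
  then show ?thesis
    by (simp add: Lp_norm_def set_lebesgue_integral_def)
qed

lemma Lp_norm_split:
  assumes p: "1 \<le> p" and f: "Lp_on p {a..c} f" and ab: "a \<le> b" "b \<le> c"
  shows "Lp_norm p {a..c} f \<le> Lp_norm p {a..b} f + Lp_norm p {b..c} f"
proof -
  have f': "Lp_on p {a..b} f" "Lp_on p {b..c} f" using f ab by (auto intro: Lp_on_subset)
  have "Lp_norm p {a..c} f \<le> Lp_norm p {a..c} (\<lambda>s. indicator {a..b} s *\<^sub>R f s) + Lp_norm p {a..c} (\<lambda>s. indicator {b..c} s *\<^sub>R f s)"
    using ab f' by (intro Lp_norm_le_add p Lp_on_indicator) (auto simp: indicator_def)
  then show ?thesis using ab by (simp add: Lp_norm_indicator)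
qed

text \<open>Fatou's lemma. It yields integrability of the limit together with the bound.\<close>

lemma Lp_on_limit_bound:
  fixes h :: "real \<Rightarrow> 'a::banach"
  assumes p: "1 \<le> p" and A: "A \<in> sets lebesgue" and C: "0 \<le> C"
    and s: "\<And>k. Lp_on p A (s k)" and h: "strongly_measurable lebesgue h"
    and lim: "AE x in lebesgue. (\<lambda>k. s k x) \<longlonglongrightarrow> h x"
    and bd: "eventually (\<lambda>k. Lp_norm p A (s k) \<le> C) sequentially"
  shows "Lp_on p A h" "Lp_norm p A h \<le> C"
proof -
  let ?u = "\<lambda>k x. ennreal (indicator A x *\<^sub>R norm (s k x) powr p)"
  let ?v = "\<lambda>x. indicator A x *\<^sub>R norm (h x) powr p"
  have meas: "(\<lambda>x. indicator A x *\<^sub>R norm (g x) powr p :: real) \<in> borel_measurable lebesgue"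
    if "strongly_measurable lebesgue g" for g :: "real \<Rightarrow> 'a"
    using A borel_measurable_norm_strongly_measurable[OF that]
    by (intro borel_measurable_scaleR borel_measurable_indicator powr_real_measurable borel_measurable_const)
  have eq: "(\<integral>\<^sup>+x. ?u k x \<partial>lebesgue) = ennreal (Lp_norm p A (s k) powr p)" for k
    using s[of k] unfolding Lp_norm_powr[OF p] Lp_on_def set_integrable_def set_lebesgue_integral_def
    by (intro nn_integral_eq_integral) auto
  have "(\<integral>\<^sup>+x. ennreal (?v x) \<partial>lebesgue) = (\<integral>\<^sup>+x. liminf (\<lambda>k. ?u k x) \<partial>lebesgue)"
  proof (rule nn_integral_cong_AE)
    show "AE x in lebesgue. ennreal (?v x) = liminf (\<lambda>k. ?u k x)"
      using lim
    proof eventually_elim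
      case (elim x)
      have "(\<lambda>k. norm (s k x) powr p) \<longlonglongrightarrow> norm (h x) powr p"
        using p by (intro tendsto_powr2 tendsto_norm elim tendsto_const) auto
      then have "(\<lambda>k. ?u k x) \<longlonglongrightarrow> ennreal (?v x)"
        by (intro tendsto_ennrealI tendsto_scaleR tendsto_const)
      then show ?case by (rule lim_imp_Liminf[OF sequentially_bot, symmetric])
    qed
  qed
  also have "\<dots> \<le> liminf (\<lambda>k. \<integral>\<^sup>+x. ?u k x \<partial>lebesgue)"
    using s by (intro nn_integral_liminf measurable_compose[OF meas measurable_ennreal]) (auto simp: Lp_on_def)
  also have "\<dots> \<le> ennreal (C powr p)"
    unfolding eq
  proof (rule Liminf_le)
    show "\<forall>\<^sub>F k in sequentially. ennreal (Lp_norm p A (s k) powr p) \<le> ennreal (C powr p)"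
      using bd by eventually_elim (use p in \<open>auto intro!: ennreal_leI powr_mono2\<close>)
  qed simp
  finally have le: "(\<integral>\<^sup>+x. ennreal (?v x) \<partial>lebesgue) \<le> ennreal (C powr p)" .
  have int: "integrable lebesgue ?v"
    using le by (intro integrableI_nonneg meas h) (auto simp: order_le_less_trans)
  then show "Lp_on p A h" using h by (simp add: Lp_on_def set_integrable_def)
  have "ennreal (\<integral>x. ?v x \<partial>lebesgue) \<le> ennreal (C powr p)"
    using nn_integral_eq_integral[OF int] le by simp
  then show "Lp_norm p A h \<le> C"
    using p C by (simp add: Lp_norm_le_iff set_lebesgue_integral_def ennreal_le_iff)
qed

text \<open>Rapid convergence in the norm is turned into pointwise convergence by the Borel--Cantelli lemma.\<close>
lemma AE_eventually_less_of_Lp_norm: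
  fixes u :: "nat \<Rightarrow> real \<Rightarrow> 'a::banach"
  assumes p: "1 \<le> p" and A: "A \<in> sets lebesgue" and u: "\<And>k. Lp_on p A (u k)"
    and bd: "\<And>k. k \<ge> K \<Longrightarrow> Lp_norm p A (u k) \<le> 3 * (1 / 8) ^ k"
  shows "AE x in lebesgue. x \<in> A \<longrightarrow> eventually (\<lambda>k. norm (u k x) < (1 / 2) ^ k) sequentially"
proof -
  \<comment> \<open>Markov's inequality compares the threshold \<open>(1 / 2) ^ k\<close> with the
    norm bound \<open>3 * (1 / 8) ^ k\<close>. The quotient \<open>3 * (1 / 4) ^ k\<close> makes the
    measures summable, also after raising it to the power \<open>p\<close>. The index is shifted by
    \<open>K\<close> because the bound holds only from there on.\<close>
  define B where "B = (\<lambda>k. {x \<in> A. norm (u (k + K) x) powr p \<ge> ((1 / 2) ^ (k + K)) powr p})"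
  have em: "emeasure lebesgue (B k) \<le> ennreal (3 powr p * (1 / 4) ^ k)" for k
  proof -
    let ?c = "((1 / 2 :: real) ^ (k + K)) powr p"
    have c: "0 < ?c" by simp
    have "emeasure lebesgue (B k) \<le> (1 / ?c) * (LINT x:A|lebesgue. norm (u (k + K) x) powr p)"
      unfolding B_def using u[of "k + K"] A c by (intro integral_Markov_inequality') (auto simp: Lp_on_def)
    also have "(LINT x:A|lebesgue. norm (u (k + K) x) powr p) \<le> (3 * (1 / 8) ^ (k + K)) powr p"
      using bd[of "k + K"] p by (simp add: Lp_norm_le_iff)
    then have "(1 / ?c) * (LINT x:A|lebesgue. norm (u (k + K) x) powr p) \<le> (1 / ?c) * (3 * (1 / 8) ^ (k + K)) powr p"
      using c by (intro mult_left_mono) auto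
    also have "\<dots> = (3 * (1 / 4) ^ (k + K)) powr p"
    proof -
      have "3 * (1 / 8 :: real) ^ (k + K) = (1 / 2) ^ (k + K) * (3 * (1 / 4) ^ (k + K))"
        by (simp flip: power_mult_distrib)
      then show ?thesis by (simp add: powr_mult)
    qed
    also have "\<dots> = 3 powr p * ((1 / 4) ^ (k + K)) powr p" by (simp add: powr_mult)
    also have "\<dots> \<le> 3 powr p * ((1 / 4) ^ (k + K)) powr 1"
      using p by (intro mult_left_mono powr_mono') (auto simp: power_le_one)
    also have "\<dots> \<le> 3 powr p * (1 / 4) ^ k"
      by (intro mult_left_mono) (auto simp: power_add power_le_one mult_left_le)
    finally show ?thesis by (simp add: ennreal_leI)
  qed
  have B: "B k \<in> sets lebesgue" for k
  proof -
    have "{x \<in> space lebesgue. norm (u (k + K) x) powr p \<ge> ((1 / 2) ^ (k + K)) powr p} \<in> sets lebesgue"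
      by (intro borel_measurable_le borel_measurable_const Lp_on_measurable[OF u])
    then have "A \<inter> {x \<in> space lebesgue. norm (u (k + K) x) powr p \<ge> ((1 / 2) ^ (k + K)) powr p} \<in> sets lebesgue"
      using A by (rule sets.Int[rotated])
    moreover have "B k = A \<inter> {x \<in> space lebesgue. norm (u (k + K) x) powr p \<ge> ((1 / 2) ^ (k + K)) powr p}"
      by (auto simp: B_def)
    ultimately show ?thesis by (simp only:)
  qed
  have "summable (\<lambda>k. measure lebesgue (B k))"
  proof (rule summable_comparison_test')
    show "summable (\<lambda>k. 3 powr p * (1 / 4 :: real) ^ k)" by (intro summable_mult summable_geometric) simp
    show "norm (measure lebesgue (B k)) \<le> 3 powr p * (1 / 4) ^ k" if "0 \<le> k" for k
      using enn2real_mono[OF em[of k]] by (simp add: measure_def)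
  qed
  moreover have "emeasure lebesgue (B k) < \<infinity>" for k
    using em[of k] by (rule order_le_less_trans) simp
  ultimately have "AE x in lebesgue. eventually (\<lambda>k. x \<in> space lebesgue - B k) sequentially"
    by (intro borel_cantelli_AE1 B)
  then show ?thesis
  proof eventually_elim
    case (elim x)
    show ?case
    proof
      assume x: "x \<in> A"
      from elim have "eventually (\<lambda>k. norm (u (k + K) x) < (1 / 2) ^ (k + K)) sequentially"
      proof eventually_elim
        case (elim k)
        then have "norm (u (k + K) x) powr p < ((1 / 2) ^ (k + K)) powr p" using x by (auto simp: B_def)
        then show ?case using p powr_mono2[of p "(1 / 2) ^ (k + K)" "norm (u (k + K) x)"] by force
      qed
      then show "eventually (\<lambda>k. norm (u k x) < (1 / 2) ^ k) sequentially"
        by (simp add: eventually_sequentially_seg[where P = "\<lambda>k. norm (u k x) < (1 / 2) ^ k"])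
    qed
  qed
qed

lemma convergent_of_geometric_increments:
  fixes s :: "nat \<Rightarrow> 'a::banach"
  assumes "eventually (\<lambda>k. norm (s (Suc k) - s k) < (1 / 2) ^ k) sequentially"
  shows "convergent s"
proof -
  have "summable (\<lambda>k. s (Suc k) - s k)"
  proof (rule summable_comparison_test_ev)
    show "\<forall>\<^sub>F k in sequentially. norm (s (Suc k) - s k) \<le> (1 / 2) ^ k"
      using assms by eventually_elim simp
  qed (simp add: summable_geometric)
  then have "convergent (\<lambda>n. s n - s 0)"
    unfolding summable_iff_convergent by (simp add: sum_lessThan_telescope)
  then show ?thesis by (simp add: convergent_diff_const_right_iff)
qed

text \<open>The Riesz-Fischer argument, run through simple functions: a rapidly Cauchy subsequence
  is replaced by simple functions \<open>s k\<close> that are close to it on growing intervals. They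
  converge almost everywhere, so the limit is strongly measurable by definition, and Fatou's lemma
  gives convergence in the seminorm.\<close>

theorem Lp_loc_complete:
  fixes f :: "nat \<Rightarrow> real \<Rightarrow> 'a::banach"
  assumes p: "1 \<le> p" and f: "\<And>n. f n \<in> Lp_loc p UNIV"
    and cauchy: "\<And>t e. 0 < e \<Longrightarrow> \<exists>N. \<forall>m\<ge>N. \<forall>n\<ge>N. Lp_norm p {t..t + 1} (\<lambda>s. f m s - f n s) < e"
  obtains g where "g \<in> Lp_loc p UNIV" "\<And>t. (\<lambda>n. Lp_norm p {t..t + 1} (\<lambda>s. f n s - g s)) \<longlonglongrightarrow> 0"
proof -
  have fd: "(\<lambda>s. f m s - f n s) \<in> Lp_loc p UNIV" for m n by (intro Lp_loc_UNIV_diff p f)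
  \<comment> \<open>The Cauchy property passes from unit windows to intervals of integer length by
    adding one window at a time.\<close>
  have cauchy_long: "\<exists>N. \<forall>m\<ge>N. \<forall>n\<ge>N. Lp_norm p {t..t + real k} (\<lambda>s. f m s - f n s) < e" if "0 < e" for t e k
    using that
  proof (induction k arbitrary: e)
    case 0
    have "Lp_norm p {t..t} (\<lambda>s. f m s - f n s) = 0" for m n
    proof -
      have "(\<integral>s. indicator {t..t} s *\<^sub>R norm (f m s - f n s) powr p \<partial>lebesgue) = 0"
      proof (rule integral_eq_zero_AE)
        have "{t} \<in> null_sets lebesgue" by simp
        then show "AE s in lebesgue. indicator {t..t} s *\<^sub>R norm (f m s - f n s) powr p = 0"
          by (rule AE_I') (auto simp: indicator_def split: if_splits)
      qed
      then show ?thesis by (simp add: Lp_norm_def set_lebesgue_integral_def)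
    qed
    with 0 show ?case by simp
  next
    case (Suc k)
    from Suc have e2: "0 < e / 2" by simp
    from Suc.IH[OF e2] cauchy[OF e2, of "t + real k"] obtain N1 N2 where
      N1: "\<And>m n. m \<ge> N1 \<Longrightarrow> n \<ge> N1 \<Longrightarrow> Lp_norm p {t..t + real k} (\<lambda>s. f m s - f n s) < e / 2" and
      N2: "\<And>m n. m \<ge> N2 \<Longrightarrow> n \<ge> N2 \<Longrightarrow> Lp_norm p {t + real k..t + real k + 1} (\<lambda>s. f m s - f n s) < e / 2" by blast
    have "Lp_norm p {t..t + real (Suc k)} (\<lambda>s. f m s - f n s) < e" if "m \<ge> max N1 N2" "n \<ge> max N1 N2" for m n
      using N1[of m n] N2[of m n] that Lp_norm_split[OF p Lp_loc_UNIV_imp_Lp_on[OF fd], of t "t + real k" "t + real k + 1" m n]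
      by (simp add: add_ac)
    then show ?case by blast
  qed
  define I where "I = (\<lambda>k::nat. {- real k..real k})"
  have I: "I j \<subseteq> I k" if "j \<le> k" for j k using that by (auto simp: I_def)
  have cauchy_I: "\<exists>N. \<forall>m\<ge>N. \<forall>n\<ge>N. Lp_norm p (I k) (\<lambda>s. f m s - f n s) < e" if "0 < e" for k e
    using cauchy_long[OF that, of "- real k" "2 * k"] by (simp add: I_def)
  have "\<exists>N. \<forall>k. \<forall>m\<ge>N k. \<forall>n\<ge>N k. Lp_norm p (I k) (\<lambda>s. f m s - f n s) < (1 / 8) ^ k"
    using cauchy_I by (intro choice allI) simp
  then obtain N where N: "\<And>k m n. m \<ge> N k \<Longrightarrow> n \<ge> N k \<Longrightarrow> Lp_norm p (I k) (\<lambda>s. f m s - f n s) < (1 / 8) ^ k"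
    by blast
  \<comment> \<open>Adding all \<open>N j\<close> with \<open>j \<le> k\<close> makes
    \<open>r\<close> monotone, so that both \<open>r k\<close> and \<open>r (Suc k)\<close> are
    beyond \<open>N k\<close>; the summand \<open>k\<close> makes it unbounded.\<close>
  define r where "r = (\<lambda>k. k + (\<Sum>j\<le>k. N j))"
  have r: "r k \<ge> N k" "r k \<ge> k" "r k \<le> r (Suc k)" for k
    using member_le_sum[of k "{..k}" N] by (auto simp: r_def)
  have "\<exists>s. simple_function lebesgue s \<and> Lp_norm p (I k) (\<lambda>x. f (r k) x - s x) < (1 / 8) ^ k" for k
    using simple_function_Lp_dense[OF p _ Lp_loc_UNIV_imp_Lp_on[OF f], of "- real k" "real k" "(1 / 8) ^ k" "r k"]
    unfolding I_def by (metis atLeastAtMost_borel lmeasurable_interval(1) fmeasurableD zero_less_divide_1_iff zero_less_numeral zero_less_power)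
  then obtain s where s: "\<And>k. simple_function lebesgue (s k)"
    and fs: "\<And>k. Lp_norm p (I k) (\<lambda>x. f (r k) x - s k x) < (1 / 8) ^ k" by metis
  have sL: "s k \<in> Lp_loc p UNIV" for k by (rule simple_function_Lp_loc[OF p s])
  have fsL: "(\<lambda>x. f m x - s k x) \<in> Lp_loc p UNIV" for m k by (intro Lp_loc_UNIV_diff p f sL)
  have LI: "Lp_on p (I k) h" if "h \<in> Lp_loc p UNIV" for k and h :: "real \<Rightarrow> 'a"
    using that unfolding I_def by (rule Lp_loc_UNIV_imp_Lp_on)
  \<comment> \<open>Three errors of at most \<open>(1 / 8) ^ k\<close> each: two from the
    approximation by simple functions, one from the Cauchy property.\<close>
  have inc: "Lp_norm p (I K) (\<lambda>x. s (Suc k) x - s k x) \<le> 3 * (1 / 8) ^ k" if "K \<le> k" for K k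
  proof -
    have "Lp_norm p (I K) (\<lambda>x. s (Suc k) x - s k x) \<le> Lp_norm p (I k) (\<lambda>x. s (Suc k) x - s k x)"
      using that by (intro Lp_norm_mono_set p LI I Lp_loc_UNIV_diff sL)
    also have "\<dots> \<le> Lp_norm p (I k) (\<lambda>x. s (Suc k) x - f (r (Suc k)) x) + Lp_norm p (I k) (\<lambda>x. f (r (Suc k)) x - s k x)"
      unfolding I_def by (intro Lp_norm_diff_triangle p sL f)
    also have "Lp_norm p (I k) (\<lambda>x. f (r (Suc k)) x - s k x)
        \<le> Lp_norm p (I k) (\<lambda>x. f (r (Suc k)) x - f (r k) x) + Lp_norm p (I k) (\<lambda>x. f (r k) x - s k x)"
      unfolding I_def by (intro Lp_norm_diff_triangle p sL f)
    also have "Lp_norm p (I k) (\<lambda>x. s (Suc k) x - f (r (Suc k)) x) = Lp_norm p (I k) (\<lambda>x. f (r (Suc k)) x - s (Suc k) x)"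
      by (rule Lp_norm_minus_commute)
    also have "\<dots> \<le> Lp_norm p (I (Suc k)) (\<lambda>x. f (r (Suc k)) x - s (Suc k) x)"
      by (intro Lp_norm_mono_set p LI I fsL) simp
    also have "\<dots> \<le> (1 / 8) ^ Suc k" using fs[of "Suc k"] by simp
    also have "\<dots> \<le> (1 / 8) ^ k" by simp
    also have "Lp_norm p (I k) (\<lambda>x. f (r (Suc k)) x - f (r k) x) \<le> (1 / 8) ^ k"
      using r[of k] by (intro less_imp_le[OF N]) auto
    also have "Lp_norm p (I k) (\<lambda>x. f (r k) x - s k x) \<le> (1 / 8) ^ k" using fs[of k] by simp
    finally show ?thesis by simp
  qed
  have "AE x in lebesgue. \<forall>K. x \<in> I K \<longrightarrow> eventually (\<lambda>k. norm (s (Suc k) x - s k x) < (1 / 2) ^ k) sequentially"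
    unfolding AE_all_countable
    by (intro allI AE_eventually_less_of_Lp_norm[OF p] LI Lp_loc_UNIV_diff p sL inc) (auto simp: I_def)
  then have lim: "AE x in lebesgue. (\<lambda>k. s k x) \<longlonglongrightarrow> lim (\<lambda>k. s k x)"
  proof eventually_elim
    case (elim x)
    obtain K where "\<bar>x\<bar> \<le> real K" using real_arch_simple by blast
    then have "x \<in> I K" by (auto simp: I_def)
    with elim have "convergent (\<lambda>k. s k x)" by (intro convergent_of_geometric_increments) blast
    then show ?case by (simp add: convergent_LIMSEQ_iff)
  qed
  \<comment> \<open>The arbitrary value of \<open>lim\<close> at points of divergence matters only
    on a null set.\<close>
  define g where "g = (\<lambda>x. lim (\<lambda>k. s k x))"
  have gm: "strongly_measurable lebesgue g"
    unfolding strongly_measurable_def g_def using s lim by blast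
  \<comment> \<open>Fatou's lemma for \<open>f n - s k\<close> as \<open>k\<close> grows. The Cauchy
    bound contributes \<open>C\<close>, and \<open>e\<close> absorbs the distance of
    \<open>f (r k)\<close> from \<open>s k\<close>.\<close>
  have key: "Lp_on p (I K) (\<lambda>x. f n x - g x)" "Lp_norm p (I K) (\<lambda>x. f n x - g x) \<le> C + e"
    if C: "0 \<le> C" and e: "0 < e" and n: "\<And>m. m \<ge> M \<Longrightarrow> Lp_norm p (I K) (\<lambda>x. f n x - f m x) \<le> C" for C M K n e
  proof -
    have bd: "eventually (\<lambda>k. Lp_norm p (I K) (\<lambda>x. f n x - s k x) \<le> C + e) sequentially"
    proof -
      have "(\<lambda>k. (1 / 8 :: real) ^ k) \<longlonglongrightarrow> 0" by (intro LIMSEQ_power_zero) simp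
      from order_tendstoD(2)[OF this e] eventually_ge_at_top[of K] eventually_ge_at_top[of M]
      show ?thesis
      proof eventually_elim
        case (elim k)
        have "Lp_norm p (I K) (\<lambda>x. f n x - s k x) \<le> Lp_norm p (I K) (\<lambda>x. f n x - f (r k) x) + Lp_norm p (I K) (\<lambda>x. f (r k) x - s k x)"
          unfolding I_def by (intro Lp_norm_diff_triangle p sL f)
        also have "Lp_norm p (I K) (\<lambda>x. f n x - f (r k) x) \<le> C"
          using r(2)[of k] elim by (intro n) simp
        also have "Lp_norm p (I K) (\<lambda>x. f (r k) x - s k x) \<le> Lp_norm p (I k) (\<lambda>x. f (r k) x - s k x)"
          using elim by (intro Lp_norm_mono_set p LI I fsL) simp
        also have "\<dots> \<le> e" using fs[of k] elim by simp
        finally show ?case by simp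
      qed
    qed
    have lim': "AE x in lebesgue. (\<lambda>k. f n x - s k x) \<longlonglongrightarrow> f n x - g x"
      using lim unfolding g_def by eventually_elim (intro tendsto_intros)
    have meas: "strongly_measurable lebesgue (\<lambda>x. f n x - g x)"
      using f[of n] gm by (intro strongly_measurable_diff) (auto simp: Lp_loc_UNIV_iff)
    have IK: "I K \<in> sets lebesgue" by (simp add: I_def)
    have on: "Lp_on p (I K) (\<lambda>x. f n x - s k x)" for k by (rule LI[OF fsL])
    have Ce: "0 \<le> C + e" using C e by simp
    show "Lp_on p (I K) (\<lambda>x. f n x - g x)" "Lp_norm p (I K) (\<lambda>x. f n x - g x) \<le> C + e"
      by (rule Lp_on_limit_bound[OF p IK Ce on meas lim' bd])+
  qed
  have gL: "g \<in> Lp_loc p UNIV"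
  proof (rule Lp_loc_UNIV_I[OF gm])
    fix a b :: real
    obtain K where K: "max \<bar>a\<bar> \<bar>b\<bar> \<le> real K" using real_arch_simple by blast
    obtain M where M: "\<And>m n. m \<ge> M \<Longrightarrow> n \<ge> M \<Longrightarrow> Lp_norm p (I K) (\<lambda>s. f m s - f n s) < 1"
      using cauchy_I[of 1 K] by auto
    then have "Lp_on p (I K) (\<lambda>x. f M x - g x)"
      by (intro key(1)[of 1 1 M]) (auto intro: less_imp_le)
    from Lp_on_diff[OF p _ LI[OF f] this, of M] have "Lp_on p (I K) g" by (simp add: I_def)
    then show "Lp_on p {a..b} g"
      by (rule Lp_on_subset) (use K in \<open>auto simp: I_def\<close>)
  qed
  moreover have "(\<lambda>n. Lp_norm p {t..t + 1} (\<lambda>s. f n s - g s)) \<longlonglongrightarrow> 0" for t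
  proof (rule LIMSEQ_I)
    fix e :: real assume e: "0 < e"
    obtain K where K: "\<bar>t\<bar> + 1 \<le> real K" using real_arch_simple by blast
    obtain M where M: "\<And>m n. m \<ge> M \<Longrightarrow> n \<ge> M \<Longrightarrow> Lp_norm p (I K) (\<lambda>s. f m s - f n s) < e / 3"
      using cauchy_I[of "e / 3" K] e by auto
    have "norm (Lp_norm p {t..t + 1} (\<lambda>s. f n s - g s) - 0) < e" if "n \<ge> M" for n
    proof -
      have "Lp_norm p {t..t + 1} (\<lambda>s. f n s - g s) \<le> Lp_norm p (I K) (\<lambda>s. f n s - g s)"
        using K by (intro Lp_norm_mono_set p LI Lp_loc_UNIV_diff f gL) (auto simp: I_def)
      also have "\<dots> \<le> e / 3 + e / 3"
        using M that e by (intro key(2)[of _ _ M]) (auto intro: less_imp_le)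
      also have "\<dots> < e" using e by simp
      finally show ?thesis by simp
    qed
    then show "\<exists>no. \<forall>n\<ge>no. norm (Lp_norm p {t..t + 1} (\<lambda>s. f n s - g s) - 0) < e" by blast
  qed
  ultimately show ?thesis by (rule that)
qed

subsection \<open>Bohr periods and Bochner's criterion\<close>

text \<open>For locally \<open>p\<close>-integrable \<open>f\<close> this is a continuous
  pseudometric on the line. All conditions on periods are expressed through it, so that they can be
  combined by triangle inequalities.\<close>

definition translation_dist :: "real \<Rightarrow> (real \<Rightarrow> 'a::banach) \<Rightarrow> real \<Rightarrow> real \<Rightarrow> real" where
  "translation_dist p f t u = Lp_norm p {0..1} (\<lambda>s. f (t + s) - f (u + s))"

lemma translation_dist_nonneg [simp]: "0 \<le> translation_dist p f t u"
  by (simp add: translation_dist_def)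

lemma translation_dist_self [simp]: "translation_dist p f t t = 0"
  by (simp add: translation_dist_def Lp_norm_def)

lemma translation_dist_commute: "translation_dist p f t u = translation_dist p f u t"
  unfolding translation_dist_def by (rule Lp_norm_minus_commute)

lemma Lp_norm_shift_diff:
  "Lp_norm p {t..t + 1} (\<lambda>s. f (a + s) - f (b + s)) = translation_dist p f (a + t) (b + t)"
  using Lp_norm_shift[of p 0 1 "\<lambda>s. f (a + s) - f (b + s)" t]
  by (simp add: translation_dist_def add_ac)

lemma Lp_norm_shift_diff':
  "Lp_norm p {t..t + 1} (\<lambda>s. f (s + a) - f s) = translation_dist p f (t + a) t"
  using Lp_norm_shift_diff[of p t f a 0] by (simp add: add_ac)

context
  fixes p :: real and f :: "real \<Rightarrow> 'a::banach"
  assumes p: "1 \<le> p" and f: "f \<in> Lp_loc p UNIV"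
begin

lemma translation_dist_triangle:
  "translation_dist p f t v \<le> translation_dist p f t u + translation_dist p f u v"
  unfolding translation_dist_def by (intro Lp_norm_diff_triangle p Lp_loc_UNIV_shift f)

lemma translation_dist_tendsto: "((\<lambda>h. translation_dist p f h t) \<longlongrightarrow> 0) (at t)"
  unfolding translation_dist_def by (rule Lp_translation_continuous[OF p f])

text \<open>By the triangle inequality the value at \<open>w\<close> differs from that at
  \<open>z\<close> by at most the sum of the distances of the two coordinates, which reduces joint
  continuity to continuity at the diagonal.\<close>

lemma translation_dist_continuous: "continuous_on UNIV (\<lambda>z. translation_dist p f (fst z) (snd z))"
  unfolding continuous_on_eq_continuous_at[OF open_UNIV]
proof
  fix z :: "real \<times> real"
  let ?d = "translation_dist p f"
  have c: "isCont (\<lambda>h. ?d h t) t" for t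
    using translation_dist_tendsto[of t] by (simp add: isCont_def)
  have "((\<lambda>w. ?d (fst w) (fst z) + ?d (snd w) (snd z)) \<longlongrightarrow> ?d (fst z) (fst z) + ?d (snd z) (snd z)) (at z)"
    by (intro tendsto_add isCont_tendsto_compose[OF c] tendsto_fst tendsto_snd tendsto_ident_at)
  then have lim: "((\<lambda>w. ?d (fst w) (fst z) + ?d (snd w) (snd z)) \<longlongrightarrow> 0) (at z)" by simp
  have "norm (?d (fst w) (snd w) - ?d (fst z) (snd z)) \<le> ?d (fst w) (fst z) + ?d (snd w) (snd z)" for w
  proof -
    have "?d (fst w) (snd w) \<le> ?d (fst w) (fst z) + (?d (fst z) (snd z) + ?d (snd w) (snd z))"
      using translation_dist_triangle[of "fst w" "snd w" "fst z"] translation_dist_triangle[of "fst z" "snd w" "snd z"]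
        translation_dist_commute[of p f "snd w" "snd z"] by linarith
    moreover have "?d (fst z) (snd z) \<le> ?d (fst w) (fst z) + (?d (fst w) (snd w) + ?d (snd w) (snd z))"
      using translation_dist_triangle[of "fst z" "snd z" "fst w"] translation_dist_triangle[of "fst w" "snd z" "snd w"]
        translation_dist_commute[of p f "fst w" "fst z"] by linarith
    ultimately show ?thesis by (simp add: abs_le_iff)
  qed
  then have "((\<lambda>w. ?d (fst w) (snd w) - ?d (fst z) (snd z)) \<longlongrightarrow> 0) (at z)"
    by (intro Lim_null_comparison[OF _ lim]) auto
  then show "isCont (\<lambda>w. ?d (fst w) (snd w)) z"
    by (simp add: isCont_def LIM_zero_iff)
qed

end

definition Bohr_periods :: "real \<Rightarrow> (real \<Rightarrow> 'a::banach) \<Rightarrow> real \<Rightarrow> real set" where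
  "Bohr_periods p f e = {\<tau>. \<forall>t. translation_dist p f (t + \<tau>) t \<le> e}"

lemma Bohr_periods_iff: "\<tau> \<in> Bohr_periods p f e \<longleftrightarrow> (\<forall>t. translation_dist p f (t + \<tau>) t \<le> e)"
  by (simp add: Bohr_periods_def)

lemma Bohr_periods_uminus: "\<tau> \<in> Bohr_periods p f e \<Longrightarrow> - \<tau> \<in> Bohr_periods p f e"
  unfolding Bohr_periods_iff using translation_dist_commute[of p f] by (metis diff_add_cancel add_uminus_conv_diff)

lemma relatively_dense_in_UNIV_iff:
  "relatively_dense_in UNIV T \<longleftrightarrow> (\<exists>l>0. \<forall>a. \<exists>\<tau>\<in>{a..a + l}. \<tau> \<in> T)"
  by (simp add: relatively_dense_in_def)

text \<open>An interval of length \<open>l\<close> lies to the right of zero, contains zero, or is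
  the reflection of an interval to the right. The separate set \<open>T'\<close> allows it to be
  applied both to positive Bohr periods on the half-line and to asymptotic periods in
  \<open>J\<close>.\<close>

lemma relatively_dense_in_half_line_symmetric:
  assumes "relatively_dense_in J T'" "{0..} \<subseteq> J" "T' \<inter> J \<subseteq> T" "0 \<in> T"
    and sym: "\<And>\<tau>. \<tau> \<in> T \<Longrightarrow> - \<tau> \<in> T"
  shows "relatively_dense_in UNIV T"
proof -
  obtain l where l: "0 < l" "\<And>a. {a..a + l} \<subseteq> J \<Longrightarrow> \<exists>\<tau>\<in>{a..a + l}. \<tau> \<in> T'"
    using assms(1) unfolding relatively_dense_in_def by blast
  have pos: "\<exists>\<tau>\<in>{a..a + l}. \<tau> \<in> T" if "0 \<le> a" for a
  proof -
    have "{a..a + l} \<subseteq> J" using that assms(2) by (auto simp: subset_iff)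
    with l(2)[of a] show ?thesis using assms(3) by blast
  qed
  have "\<exists>\<tau>\<in>{a..a + l}. \<tau> \<in> T" for a
  proof -
    consider "0 \<le> a" | "a \<le> 0" "0 \<le> a + l" | "a + l \<le> 0" by linarith
    then show ?thesis
    proof cases
      case 1 then show ?thesis by (rule pos)
    next
      case 2 then show ?thesis using assms(4) by (intro bexI[of _ 0]) auto
    next
      case 3
      then obtain \<tau> where "\<tau> \<in> {- a - l..- a - l + l}" "\<tau> \<in> T" using pos[of "- a - l"] by auto
      then show ?thesis by (intro bexI[of _ "- \<tau>"] sym) auto
    qed
  qed
  with l(1) show ?thesis unfolding relatively_dense_in_UNIV_iff by blast
qed

text \<open>A Bohr period moves \<open>t\<close> and \<open>u\<close> together into a fixed compact
  interval at a cost of \<open>e / 4\<close> each. There the pseudometric is uniformly continuous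
  and vanishes on the diagonal.\<close>

lemma translation_dist_uniformly_continuous:
  fixes f :: "real \<Rightarrow> 'a::banach"
  assumes p: "1 \<le> p" and f: "f \<in> Lp_loc p UNIV"
    and ap: "\<And>e. 0 < e \<Longrightarrow> relatively_dense_in UNIV (Bohr_periods p f e)" and e: "0 < e"
  obtains d where "0 < d" "\<And>t u. \<bar>t - u\<bar> < d \<Longrightarrow> translation_dist p f t u < e"
proof -
  let ?d = "translation_dist p f"
  obtain l where l: "0 < l" "\<And>a. \<exists>\<tau>\<in>{a..a + l}. \<tau> \<in> Bohr_periods p f (e / 4)"
    using ap[of "e / 4"] e by (auto simp: relatively_dense_in_UNIV_iff)
  \<comment> \<open>The period puts \<open>t + \<sigma>\<close> between \<open>0\<close> and
    \<open>l\<close>; the margin 1 accommodates \<open>u + \<sigma>\<close>.\<close>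
  let ?K = "{- 1..l + 1} \<times> {- 1..l + 1}"
  have "uniformly_continuous_on ?K (\<lambda>z. ?d (fst z) (snd z))"
    by (intro compact_uniformly_continuous compact_Times continuous_on_subset[OF translation_dist_continuous[OF p f]]) auto
  then obtain \<delta> where \<delta>: "0 < \<delta>" and cont: "\<And>z w. z \<in> ?K \<Longrightarrow> w \<in> ?K \<Longrightarrow> dist w z < \<delta> \<Longrightarrow>
      dist (?d (fst w) (snd w)) (?d (fst z) (snd z)) < e / 4"
    unfolding uniformly_continuous_on_def using e by (metis zero_less_divide_iff zero_less_numeral)
  have "?d t u < e" if tu: "\<bar>t - u\<bar> < min \<delta> 1" for t u
  proof -
    obtain \<sigma> where \<sigma>: "\<sigma> \<in> {- t..- t + l}" "\<sigma> \<in> Bohr_periods p f (e / 4)" using l(2) by blast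
    have "dist (t + \<sigma>, u + \<sigma>) (u + \<sigma>, u + \<sigma>) < \<delta>"
      using tu by (simp add: dist_Pair_Pair dist_real_def)
    then have "?d (t + \<sigma>) (u + \<sigma>) < e / 4"
      using cont[of "(u + \<sigma>, u + \<sigma>)" "(t + \<sigma>, u + \<sigma>)"] \<sigma>(1) tu by (auto simp: dist_real_def abs_less_iff)
    moreover have "?d t (t + \<sigma>) \<le> e / 4" "?d (u + \<sigma>) u \<le> e / 4"
      using \<sigma>(2) translation_dist_commute[of p f t] by (auto simp: Bohr_periods_iff)
    moreover have "?d t u \<le> ?d t (t + \<sigma>) + (?d (t + \<sigma>) (u + \<sigma>) + ?d (u + \<sigma>) u)"
      using translation_dist_triangle[OF p f, of t u "t + \<sigma>"] translation_dist_triangle[OF p f, of "t + \<sigma>" u "u + \<sigma>"] by linarith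
    ultimately show ?thesis using e by linarith
  qed
  then show ?thesis using \<delta> by (intro that[of "min \<delta> 1"]) auto
qed

text \<open>Adding suitable Bohr periods to the \<open>a n\<close> brings them into the compact
  interval from \<open>0\<close> to \<open>l\<close>, where a subsequence converges. Uniform
  continuity makes its translates close, uniformly in \<open>t\<close>.\<close>

lemma Bochner_subsequence:
  fixes f :: "real \<Rightarrow> 'a::banach" and a :: "nat \<Rightarrow> real"
  assumes p: "1 \<le> p" and f: "f \<in> Lp_loc p UNIV"
    and ap: "\<And>e. 0 < e \<Longrightarrow> relatively_dense_in UNIV (Bohr_periods p f e)" and e: "0 < e"
  obtains r where "strict_mono (r :: nat \<Rightarrow> nat)"
    "\<And>m n t. translation_dist p f (t + a (r m)) (t + a (r n)) \<le> e"
proof -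
  let ?d = "translation_dist p f"
  obtain d where d: "0 < d" "\<And>t u. \<bar>t - u\<bar> < d \<Longrightarrow> ?d t u < e / 3"
    using translation_dist_uniformly_continuous[OF p f ap, of "e / 3"] e by auto
  obtain l where l: "0 < l" "\<And>a. \<exists>\<tau>\<in>{a..a + l}. \<tau> \<in> Bohr_periods p f (e / 3)"
    using ap[of "e / 3"] e by (auto simp: relatively_dense_in_UNIV_iff)
  have "\<exists>\<sigma>. \<forall>n. \<sigma> n \<in> {- a n..- a n + l} \<and> \<sigma> n \<in> Bohr_periods p f (e / 3)"
    using l(2) by (intro choice allI) blast
  then obtain \<sigma> where \<sigma>: "\<And>n. \<sigma> n \<in> {- a n..- a n + l}" "\<And>n. \<sigma> n \<in> Bohr_periods p f (e / 3)" by blast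
  define b where "b = (\<lambda>n. a n + \<sigma> n)"
  have "b n \<in> {0..l}" for n using \<sigma>(1)[of n] by (auto simp: b_def)
  then obtain r c where r: "strict_mono r" "(b \<circ> r) \<longlonglongrightarrow> c"
    using compact_Icc[of 0 l, unfolded compact_def] by blast
  have "Cauchy (b \<circ> r)" using r(2) by (simp add: LIMSEQ_imp_Cauchy)
  then obtain N where N: "\<And>m n. m \<ge> N \<Longrightarrow> n \<ge> N \<Longrightarrow> \<bar>b (r m) - b (r n)\<bar> < d"
    unfolding Cauchy_def using d(1) by (force simp: dist_real_def)
  \<comment> \<open>Dropping the first \<open>N\<close> terms gives the bound for all indices, a
    property inherited by subsequences as the diagonal argument requires.\<close>
  have "?d (t + a (r (m + N))) (t + a (r (n + N))) \<le> e" for m n t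
  proof -
    let ?m = "r (m + N)" and ?n = "r (n + N)"
    have "?d (t + a ?m) (t + a ?m + \<sigma> ?m) \<le> e / 3" "?d (t + a ?n + \<sigma> ?n) (t + a ?n) \<le> e / 3"
      using \<sigma>(2)[of ?m] \<sigma>(2)[of ?n] translation_dist_commute[of p f "t + a ?m"] by (auto simp: Bohr_periods_iff)
    moreover have "?d (t + a ?m + \<sigma> ?m) (t + a ?n + \<sigma> ?n) < e / 3"
      using N[of "m + N" "n + N"] by (intro d(2)) (simp add: b_def algebra_simps)
    ultimately show ?thesis
      using translation_dist_triangle[OF p f, of "t + a ?m" "t + a ?n" "t + a ?m + \<sigma> ?m"]
        translation_dist_triangle[OF p f, of "t + a ?m + \<sigma> ?m" "t + a ?n" "t + a ?n + \<sigma> ?n"] by linarith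
  qed
  moreover have "strict_mono (\<lambda>n. r (n + N))" using r(1) by (auto simp: strict_mono_def)
  ultimately show ?thesis by (intro that[of "\<lambda>n. r (n + N)"])
qed

lemma Bochner_diagonal_subsequence:
  fixes f :: "real \<Rightarrow> 'a::banach" and a :: "nat \<Rightarrow> real"
  assumes p: "1 \<le> p" and f: "f \<in> Lp_loc p UNIV"
    and ap: "\<And>e. 0 < e \<Longrightarrow> relatively_dense_in UNIV (Bohr_periods p f e)"
  obtains r where "strict_mono (r :: nat \<Rightarrow> nat)"
    "\<And>k m n t. m > k \<Longrightarrow> n > k \<Longrightarrow> translation_dist p f (t + a (r m)) (t + a (r n)) \<le> (1 / 2) ^ k"
proof -
  define P where "P = (\<lambda>k (s :: nat \<Rightarrow> nat). \<forall>m n t. translation_dist p f (t + a (s m)) (t + a (s n)) \<le> (1 / 2) ^ k)"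
  interpret subseqs P
  proof
    fix k and s :: "nat \<Rightarrow> nat" assume "strict_mono s"
    have "0 < (1 / 2 :: real) ^ k" by simp
    from p f ap this show "\<exists>r'. strict_mono r' \<and> P k (s \<circ> r')"
    proof (rule Bochner_subsequence[where a = "a \<circ> s"])
      fix r :: "nat \<Rightarrow> nat"
      assume "strict_mono r" "\<And>m n t. translation_dist p f (t + (a \<circ> s) (r m)) (t + (a \<circ> s) (r n)) \<le> (1 / 2) ^ k"
      then show "\<exists>r'. strict_mono r' \<and> P k (s \<circ> r')" by (auto simp: P_def)
    qed
  qed
  \<comment> \<open>From index \<open>Suc k\<close> on, the diagonal sequence is a subsequence of
    the one extracted for the bound \<open>(1 / 2) ^ k\<close>; hence the strict inequalities
    \<open>m > k\<close> and \<open>n > k\<close>.\<close>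
  have "P k (diagseq \<circ> ((+) (Suc k)))" for k
    by (rule diagseq_holds) (auto simp: P_def)
  then have *: "translation_dist p f (t + a (diagseq (Suc k + m))) (t + a (diagseq (Suc k + n))) \<le> (1 / 2) ^ k" for k m n t
    by (simp add: P_def)
  have "translation_dist p f (t + a (diagseq m)) (t + a (diagseq n)) \<le> (1 / 2) ^ k" if "m > k" "n > k" for k m n t
    using *[of t k "m - Suc k" "n - Suc k"] that by simp
  then show ?thesis using subseq_diagseq by (intro that[of diagseq])
qed

lemma Lp_norm_diff_limit_le:
  fixes f :: "nat \<Rightarrow> real \<Rightarrow> 'a::banach"
  assumes p: "1 \<le> p" and L: "\<And>n. f n \<in> Lp_loc p UNIV" "g \<in> Lp_loc p UNIV" "h \<in> Lp_loc p UNIV"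
    and lim: "(\<lambda>n. Lp_norm p {a..b} (\<lambda>s. f n s - g s)) \<longlonglongrightarrow> 0"
    and le: "eventually (\<lambda>n. Lp_norm p {a..b} (\<lambda>s. h s - f n s) \<le> C) sequentially"
  shows "Lp_norm p {a..b} (\<lambda>s. h s - g s) \<le> C"
proof (rule tendsto_lowerbound[OF _ _ sequentially_bot])
  show "(\<lambda>n. C + Lp_norm p {a..b} (\<lambda>s. f n s - g s)) \<longlonglongrightarrow> C"
    using tendsto_add[OF tendsto_const lim, of C] by simp
  show "\<forall>\<^sub>F n in sequentially. Lp_norm p {a..b} (\<lambda>s. h s - g s) \<le> C + Lp_norm p {a..b} (\<lambda>s. f n s - g s)"
    using le
  proof eventually_elim
    case (elim n)
    then show ?case using Lp_norm_diff_triangle[OF p L(3,1,2), of a b n] by linarith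
  qed
qed

text \<open>The translates along the diagonal subsequence are Cauchy on every unit window with a
  rate independent of the window. Completeness gives the limit \<open>g\<close>, and uniformity of
  the rate gives the return to \<open>f\<close>.\<close>

lemma Bohr_imp_SpAA:
  fixes f :: "real \<Rightarrow> 'a::banach"
  assumes p: "1 \<le> p" and f: "f \<in> Lp_loc p UNIV"
    and ap: "\<And>e. 0 < e \<Longrightarrow> relatively_dense_in UNIV (Bohr_periods p f e)"
  shows "f \<in> SpAA p"
proof -
  have "\<exists>r. strict_mono r \<and> (\<exists>g \<in> Lp_loc p UNIV. \<forall>t.
     (\<lambda>k. Lp_norm p {t..t + 1} (\<lambda>s. f (a (r k) + s) - g s)) \<longlonglongrightarrow> 0 \<and>
     (\<lambda>k. Lp_norm p {t..t + 1} (\<lambda>s. g (s - a (r k)) - f s)) \<longlonglongrightarrow> 0)" for a :: "nat \<Rightarrow> real"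
  proof -
    obtain r where r: "strict_mono r"
      and rd: "\<And>k m n t. m > k \<Longrightarrow> n > k \<Longrightarrow> translation_dist p f (t + a (r m)) (t + a (r n)) \<le> (1 / 2) ^ k"
      using Bochner_diagonal_subsequence[OF p f ap, of a] by blast
    have fL: "(\<lambda>s. f (b + s)) \<in> Lp_loc p UNIV" for b by (rule Lp_loc_UNIV_shift[OF f])
    have le: "Lp_norm p {t..t + 1} (\<lambda>s. f (a (r m) + s) - f (a (r n) + s)) \<le> (1 / 2) ^ k" if "m > k" "n > k" for k m n t
      unfolding Lp_norm_shift_diff using rd[OF that, of t] by (simp add: add_ac)
    have small: "\<exists>k. (1 / 2 :: real) ^ k < e" if "0 < e" for e
      using that by (intro real_arch_pow_inv) auto
    have cauchy: "\<exists>N. \<forall>m\<ge>N. \<forall>n\<ge>N. Lp_norm p {t..t + 1} (\<lambda>s. f (a (r m) + s) - f (a (r n) + s)) < e"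
      if "0 < e" for t e
    proof -
      from small[OF that] obtain k where "(1 / 2) ^ k < e" by blast
      then show ?thesis
        by (intro exI[of _ "Suc k"] allI impI order_le_less_trans[OF le[of k]]) auto
    qed
    obtain g where g: "g \<in> Lp_loc p UNIV"
      and lim: "\<And>t. (\<lambda>n. Lp_norm p {t..t + 1} (\<lambda>s. f (a (r n) + s) - g s)) \<longlonglongrightarrow> 0"
      using Lp_loc_complete[of p "\<lambda>n s. f (a (r n) + s)", OF p fL cauchy] by blast
    have unif: "Lp_norm p {t..t + 1} (\<lambda>s. f (a (r n) + s) - g s) \<le> (1 / 2) ^ k" if "n > k" for k n t
    proof (rule Lp_norm_diff_limit_le[OF p fL g fL lim])
      show "\<forall>\<^sub>F m in sequentially. Lp_norm p {t..t + 1} (\<lambda>s. f (a (r n) + s) - f (a (r m) + s)) \<le> (1 / 2) ^ k"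
        using eventually_gt_at_top[of k] by eventually_elim (use that in \<open>auto intro: le\<close>)
    qed
    \<comment> \<open>The return error at \<open>t\<close> is the forward error on the window
      starting at \<open>t - a (r n)\<close>. This window moves with \<open>n\<close>, which is why
      the uniform estimate \<open>unif\<close> is used and not merely \<open>lim\<close>.\<close>
    have reverse: "Lp_norm p {t..t + 1} (\<lambda>s. g (s - a (r n)) - f s) = Lp_norm p {t - a (r n)..t - a (r n) + 1} (\<lambda>s. f (a (r n) + s) - g s)" for t n
      using Lp_norm_shift[of p "t - a (r n)" "t - a (r n) + 1" "\<lambda>s. g (s - a (r n)) - f s" "a (r n)"]
      by (subst Lp_norm_minus_commute) (simp add: add_ac)
    have "(\<lambda>n. Lp_norm p {t..t + 1} (\<lambda>s. g (s - a (r n)) - f s)) \<longlonglongrightarrow> 0" for t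
    proof (rule LIMSEQ_I)
      fix e :: real assume "0 < e"
      from small[OF this] obtain k where k: "(1 / 2) ^ k < e" by blast
      have "norm (Lp_norm p {t..t + 1} (\<lambda>s. g (s - a (r n)) - f s) - 0) < e" if "n \<ge> Suc k" for n
        unfolding reverse using unif[of k n "t - a (r n)"] that k by simp
      then show "\<exists>no. \<forall>n\<ge>no. norm (Lp_norm p {t..t + 1} (\<lambda>s. g (s - a (r n)) - f s) - 0) < e" by blast
    qed
    with r g lim show ?thesis by blast
  qed
  with f show ?thesis by (simp add: SpAA_def Lp_norm_tendsto_0_iff[OF p])
qed

section \<open>Periods of almost automorphic functions\<close>

text \<open>Transfers approximate periods between two functions at the cost of their distance on the
  two windows concerned.\<close>

lemma translation_dist_perturb:
  fixes u v :: "real \<Rightarrow> 'a::banach"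
  assumes p: "1 \<le> p" and u: "u \<in> Lp_loc p UNIV" and v: "v \<in> Lp_loc p UNIV"
  shows "translation_dist p v a b \<le> translation_dist p u a b
    + Lp_norm p {a..a + 1} (\<lambda>s. u s - v s) + Lp_norm p {b..b + 1} (\<lambda>s. u s - v s)"
proof -
  have L: "(\<lambda>s. v (t + s)) \<in> Lp_loc p UNIV" "(\<lambda>s. u (t + s)) \<in> Lp_loc p UNIV" for t
    using v u by (auto intro: Lp_loc_UNIV_shift)
  have sh: "Lp_norm p {0..1} (\<lambda>s. u (t + s) - v (t + s)) = Lp_norm p {t..t + 1} (\<lambda>s. u s - v s)" for t
    using Lp_norm_shift[of p 0 1 "\<lambda>s. u s - v s" t] by simp
  have "translation_dist p v a b \<le>
    Lp_norm p {0..1} (\<lambda>s. v (a + s) - u (a + s)) + Lp_norm p {0..1} (\<lambda>s. u (a + s) - v (b + s))"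
    unfolding translation_dist_def by (intro Lp_norm_diff_triangle p L)
  also have "Lp_norm p {0..1} (\<lambda>s. u (a + s) - v (b + s)) \<le>
    translation_dist p u a b + Lp_norm p {0..1} (\<lambda>s. u (b + s) - v (b + s))"
    unfolding translation_dist_def by (intro Lp_norm_diff_triangle p L)
  finally show ?thesis
    unfolding Lp_norm_minus_commute[of p "{0..1}" "\<lambda>s. v (a + s)"] sh by linarith
qed

text \<open>Translation by large numbers carries every fixed \<open>t\<close> beyond
  \<open>M\<close>, so the limit \<open>g\<close> satisfies the estimate at every \<open>t\<close>.
  All translates of \<open>g\<close> then do so too, and the second limit returns the estimate to
  \<open>f\<close> with the same \<open>e\<close>.\<close>

lemma SpAA_asymptotic_period:
  fixes f :: "real \<Rightarrow> 'a::banach"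
  assumes p: "1 \<le> p" and f: "f \<in> SpAA p"
    and per: "\<And>t. t \<ge> M \<Longrightarrow> translation_dist p f (t + \<tau>) t \<le> e"
  shows "\<tau> \<in> Bohr_periods p f e"
proof -
  have fL: "f \<in> Lp_loc p UNIV" using f by (simp add: SpAA_def)
  \<comment> \<open>Almost automorphy is applied to the sequence \<open>real\<close> of natural
    numbers, which tends to infinity along every subsequence.\<close>
  obtain r g where r: "strict_mono r" and g: "g \<in> Lp_loc p UNIV"
    and lim1: "\<And>t. (\<lambda>k. Lp_norm p {t..t + 1} (\<lambda>s. f (real (r k) + s) - g s)) \<longlonglongrightarrow> 0"
    and lim2: "\<And>t. (\<lambda>k. Lp_norm p {t..t + 1} (\<lambda>s. g (s - real (r k)) - f s)) \<longlonglongrightarrow> 0"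
    using f[unfolded SpAA_def, simplified, THEN conjunct2, rule_format, of real]
    unfolding Lp_norm_tendsto_0_iff[OF p] by blast
  \<comment> \<open>For fixed \<open>\<tau>\<close> and \<open>t\<close> the estimate is closed
    under convergence on unit windows. It is used once on the way to \<open>g\<close> and once on
    the way back.\<close>
  have limit: "translation_dist p v (t + \<tau>) t \<le> e"
    if v: "v \<in> Lp_loc p UNIV" and u: "\<And>k. u k \<in> Lp_loc p UNIV"
      and lim: "\<And>t. (\<lambda>k. Lp_norm p {t..t + 1} (\<lambda>s. u k s - v s)) \<longlonglongrightarrow> 0"
      and ev: "eventually (\<lambda>k. translation_dist p (u k) (t + \<tau>) t \<le> e) sequentially"
    for u v and t
  proof (rule tendsto_lowerbound[OF _ _ sequentially_bot])
    let ?E = "\<lambda>k t. Lp_norm p {t..t + 1} (\<lambda>s. u k s - v s)"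
    have "(\<lambda>k. e + ?E k (t + \<tau>) + ?E k t) \<longlonglongrightarrow> e + 0 + 0"
      by (intro tendsto_add lim tendsto_const)
    then show "(\<lambda>k. e + ?E k (t + \<tau>) + ?E k t) \<longlonglongrightarrow> e" by simp
    show "\<forall>\<^sub>F k in sequentially. translation_dist p v (t + \<tau>) t \<le> e + ?E k (t + \<tau>) + ?E k t"
      using ev
    proof eventually_elim
      case (elim k)
      then show ?case using translation_dist_perturb[OF p u v, of "t + \<tau>" t k] by linarith
    qed
  qed
  have "translation_dist p g (t + \<tau>) t \<le> e" for t
  proof (rule limit[OF g _ lim1])
    show "(\<lambda>s. f (real (r k) + s)) \<in> Lp_loc p UNIV" for k by (rule Lp_loc_UNIV_shift[OF fL])
    show "\<forall>\<^sub>F k in sequentially. translation_dist p (\<lambda>s. f (real (r k) + s)) (t + \<tau>) t \<le> e"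
      using eventually_ge_at_top[of "nat \<lceil>M - t\<rceil>"]
    proof eventually_elim
      case (elim k)
      then have "real (r k) + t \<ge> M" using seq_suble[OF r, of k] by linarith
      from per[OF this] show ?case by (simp add: translation_dist_def add_ac)
    qed
  qed
  moreover have "translation_dist p (\<lambda>s. g (s - c)) (t + \<tau>) t = translation_dist p g (t - c + \<tau>) (t - c)" for c t
    unfolding translation_dist_def by (intro arg_cong[where f = "Lp_norm p {0..1}"] ext) (simp add: algebra_simps)
  ultimately have "\<forall>\<^sub>F k in sequentially. translation_dist p (\<lambda>s. g (s - real (r k))) (t + \<tau>) t \<le> e" for t
    by simp
  moreover have "(\<lambda>s. g (s - real (r k))) \<in> Lp_loc p UNIV" for k
    using Lp_loc_UNIV_shift[OF g, of "- real (r k)"] by simp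
  ultimately have "translation_dist p f (t + \<tau>) t \<le> e" for t
    by (intro limit[OF fL _ lim2])
  then show ?thesis by (simp add: Bohr_periods_iff)
qed

subsection \<open>Decomposition of asymptotically almost periodic functions\<close>

lemma relatively_dense_in_mono:
  assumes "relatively_dense_in J T" "\<And>\<tau>. \<tau> \<in> J \<Longrightarrow> \<tau> \<in> T \<Longrightarrow> \<tau> \<in> T'"
  shows "relatively_dense_in J T'"
  using assms unfolding relatively_dense_in_def by (meson subsetD)

lemma relatively_dense_in_ge:
  assumes "relatively_dense_in J T" "{0..} \<subseteq> J"
  obtains \<tau> where "\<tau> \<ge> b" "\<tau> \<ge> 0" "\<tau> \<in> T"
proof -
  obtain l where l: "0 < l" "\<And>a. {a..a + l} \<subseteq> J \<Longrightarrow> \<exists>\<tau>\<in>{a..a + l}. \<tau> \<in> T"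
    using assms(1) unfolding relatively_dense_in_def by blast
  have "{max 0 b..max 0 b + l} \<subseteq> J" using assms(2) by (auto simp: subset_iff)
  with l(2) obtain \<tau> where "\<tau> \<in> {max 0 b..max 0 b + l}" "\<tau> \<in> T" by blast
  then show ?thesis by (intro that[of \<tau>]) auto
qed

text \<open>The limit \<open>h\<close> of the translates by \<open>\<tau> n\<close> exists on the
  whole line even if \<open>I\<close> is a half-line. Asymptotic periods of \<open>f\<close> become
  Bohr periods of \<open>h\<close>, because any fixed window is eventually translated beyond the
  threshold; and \<open>f\<close> is close to \<open>h\<close> far out because each
  \<open>\<tau> k\<close> is itself an asymptotic period.\<close>

lemma asymptotic_almost_periodic_decomposition:
  fixes f :: "real \<Rightarrow> 'a::banach"
  assumes p: "1 \<le> p" and f: "f \<in> Lp_loc p UNIV" and I: "I = UNIV \<or> I = {0..}"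
    and aap: "\<And>e. 0 < e \<Longrightarrow> \<exists>M>0. relatively_dense_in I
      {\<tau>. \<forall>t\<in>I. t + \<tau> \<in> I \<and> \<bar>t\<bar> \<ge> M \<and> \<bar>t + \<tau>\<bar> \<ge> M \<longrightarrow> translation_dist p f (t + \<tau>) t \<le> e}"
  obtains h where "h \<in> Lp_loc p UNIV" "\<And>e. 0 < e \<Longrightarrow> relatively_dense_in UNIV (Bohr_periods p h e)"
    "\<And>e. 0 < e \<Longrightarrow> \<exists>M. \<forall>t\<in>I. \<bar>t\<bar> \<ge> M \<longrightarrow> Lp_norm p {t..t + 1} (\<lambda>s. f s - h s) \<le> e"
proof -
  let ?d = "translation_dist p f"
  have I0: "{0..} \<subseteq> I" using I by auto
  define T where "T = (\<lambda>M e. {\<tau>. \<forall>t\<in>I. t + \<tau> \<in> I \<and> \<bar>t\<bar> \<ge> M \<and> \<bar>t + \<tau>\<bar> \<ge> M \<longrightarrow> ?d (t + \<tau>) t \<le> e})"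
  have "\<exists>M. \<forall>k::nat. M k > 0 \<and> relatively_dense_in I (T (M k) ((1 / 2) ^ k))"
    using aap unfolding T_def by (intro choice allI) force
  then obtain M :: "nat \<Rightarrow> real" where M: "\<And>k. M k > 0" "\<And>k. relatively_dense_in I (T (M k) ((1 / 2) ^ k))" by blast
  have T_pos: "?d (t + \<tau>) t \<le> (1 / 2) ^ k" if "\<tau> \<in> T (M k) ((1 / 2) ^ k)" "\<tau> \<ge> 0" "t \<ge> M k" for \<tau> k t
    using that M(1)[of k] I0 unfolding T_def by (auto simp: subset_iff)
  have shift: "\<exists>\<sigma>\<ge>b. \<sigma> \<in> T (M k) ((1 / 2) ^ k) \<and> \<sigma> \<ge> 0" for k b
    by (rule relatively_dense_in_ge[OF M(2) I0, of b k]) blast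
  have "\<exists>\<tau>. \<forall>n. \<tau> n \<ge> real n \<and> \<tau> n \<in> T (M n) ((1 / 2) ^ n) \<and> \<tau> n \<ge> 0"
    using shift by (intro choice allI) blast
  then obtain \<tau> where \<tau>: "\<And>n. \<tau> n \<ge> real n" "\<And>n. \<tau> n \<in> T (M n) ((1 / 2) ^ n)" "\<And>n. \<tau> n \<ge> 0" by blast
  have pow: "(1 / 2 :: real) ^ n \<le> (1 / 2) ^ k" if "n \<ge> k" for n k :: nat
    using that by (intro power_decreasing) auto
  have small: "\<exists>k. c * (1 / 2 :: real) ^ k < e" if "0 < e" "0 < c" for e c
  proof -
    obtain k where "(1 / 2) ^ k < e / c" using real_arch_pow_inv[of "e / c" "1 / 2"] \<open>0 < e\<close> \<open>0 < c\<close> by auto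
    then show ?thesis using \<open>0 < c\<close> by (auto simp: field_simps)
  qed
  \<comment> \<open>The route goes from \<open>\<tau> n + t\<close> to
    \<open>\<tau> n + t + \<sigma>\<close>, then to \<open>t + \<sigma>\<close>,
    \<open>\<tau> m + t + \<sigma>\<close> and \<open>\<tau> m + t\<close>. The shift
    \<open>\<sigma>\<close> is so large that \<open>t + \<sigma>\<close> exceeds both
    \<open>M n\<close> and \<open>M m\<close>; each of the four steps costs at most
    \<open>(1 / 2) ^ k\<close>.\<close>
  have close: "?d (\<tau> n + t) (\<tau> m + t) \<le> 4 * (1 / 2) ^ k"
    if nm: "n \<ge> k" "m \<ge> k" and t: "\<tau> n + t \<ge> M k" "\<tau> m + t \<ge> M k" for n m k t
  proof -
    obtain \<sigma> where \<sigma>: "\<sigma> \<ge> max (M n) (M m) - t" "\<sigma> \<in> T (M k) ((1 / 2) ^ k)" "\<sigma> \<ge> 0" using shift by blast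
    have "?d (\<tau> n + t) (\<tau> n + t + \<sigma>) \<le> (1 / 2) ^ k"
      using T_pos[OF \<sigma>(2,3) t(1)] by (subst translation_dist_commute)
    moreover have "?d (\<tau> n + t + \<sigma>) (t + \<sigma>) \<le> (1 / 2) ^ k"
      using order_trans[OF T_pos[OF \<tau>(2,3), of n "t + \<sigma>"] pow[OF nm(1)]] \<sigma>(1) by (simp add: add_ac)
    moreover have "?d (t + \<sigma>) (\<tau> m + t + \<sigma>) \<le> (1 / 2) ^ k"
      using order_trans[OF T_pos[OF \<tau>(2,3), of m "t + \<sigma>"] pow[OF nm(2)]] \<sigma>(1)
      by (subst translation_dist_commute) (simp add: add_ac)
    moreover have "?d (\<tau> m + t + \<sigma>) (\<tau> m + t) \<le> (1 / 2) ^ k"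
      by (rule T_pos[OF \<sigma>(2,3) t(2)])
    moreover have "?d (\<tau> n + t) (\<tau> m + t) \<le> ?d (\<tau> n + t) (\<tau> n + t + \<sigma>) + ?d (\<tau> n + t + \<sigma>) (t + \<sigma>)
      + ?d (t + \<sigma>) (\<tau> m + t + \<sigma>) + ?d (\<tau> m + t + \<sigma>) (\<tau> m + t)"
      using translation_dist_triangle[OF p f, of "\<tau> n + t" "\<tau> m + t" "\<tau> n + t + \<sigma>"]
        translation_dist_triangle[OF p f, of "\<tau> n + t + \<sigma>" "\<tau> m + t" "t + \<sigma>"]
        translation_dist_triangle[OF p f, of "t + \<sigma>" "\<tau> m + t" "\<tau> m + t + \<sigma>"] by linarith
    ultimately show ?thesis by linarith
  qed
  have far: "\<exists>N. \<forall>n\<ge>N. \<tau> n + t \<ge> B" for t B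
  proof (intro exI allI impI)
    fix n assume "n \<ge> nat \<lceil>B - t\<rceil>"
    then have "real n \<ge> B - t" by linarith
    then show "\<tau> n + t \<ge> B" using \<tau>(1)[of n] by linarith
  qed
  have fL: "(\<lambda>s. f (b + s)) \<in> Lp_loc p UNIV" for b by (rule Lp_loc_UNIV_shift[OF f])
  have cauchy: "\<exists>N. \<forall>m\<ge>N. \<forall>n\<ge>N. Lp_norm p {t..t + 1} (\<lambda>s. f (\<tau> m + s) - f (\<tau> n + s)) < e" if "0 < e" for t e
  proof -
    obtain k where k: "4 * (1 / 2) ^ k < e" using small[of e 4] \<open>0 < e\<close> by auto
    obtain N where N: "\<And>n. n \<ge> N \<Longrightarrow> \<tau> n + t \<ge> M k" using far by blast
    have "Lp_norm p {t..t + 1} (\<lambda>s. f (\<tau> m + s) - f (\<tau> n + s)) < e" if "m \<ge> max N k" "n \<ge> max N k" for m n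
      unfolding Lp_norm_shift_diff using order_le_less_trans[OF close[of k m n t] k] N[of m] N[of n] that by auto
    then show ?thesis by blast
  qed
  obtain h where h: "h \<in> Lp_loc p UNIV"
    and lim: "\<And>t. (\<lambda>n. Lp_norm p {t..t + 1} (\<lambda>s. f (\<tau> n + s) - h s)) \<longlonglongrightarrow> 0"
    using Lp_loc_complete[of p "\<lambda>n s. f (\<tau> n + s)", OF p fL cauchy] by blast
  have close_h: "Lp_norm p {t..t + 1} (\<lambda>s. f (\<tau> n + s) - h s) \<le> 4 * (1 / 2) ^ k"
    if n: "n \<ge> k" and t: "\<tau> n + t \<ge> M k" for n k t
  proof (rule Lp_norm_diff_limit_le[OF p fL h fL lim])
    obtain N where N: "\<And>n. n \<ge> N \<Longrightarrow> \<tau> n + t \<ge> M k" using far by blast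
    show "\<forall>\<^sub>F m in sequentially. Lp_norm p {t..t + 1} (\<lambda>s. f (\<tau> n + s) - f (\<tau> m + s)) \<le> 4 * (1 / 2) ^ k"
      using eventually_ge_at_top[of N] eventually_ge_at_top[of k]
      unfolding Lp_norm_shift_diff by eventually_elim (use n t N in \<open>auto intro: close\<close>)
  qed
  \<comment> \<open>One error for replacing \<open>f\<close> by its translate by
    \<open>\<tau> k\<close>, and four from \<open>close_h\<close>.\<close>
  have right: "Lp_norm p {t..t + 1} (\<lambda>s. f s - h s) \<le> 5 * (1 / 2) ^ k" if t: "t \<ge> M k" for t k
  proof -
    have "Lp_norm p {t..t + 1} (\<lambda>s. f s - h s)
      \<le> Lp_norm p {t..t + 1} (\<lambda>s. f s - f (\<tau> k + s)) + Lp_norm p {t..t + 1} (\<lambda>s. f (\<tau> k + s) - h s)"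
      by (intro Lp_norm_diff_triangle p f h fL)
    also have "Lp_norm p {t..t + 1} (\<lambda>s. f s - f (\<tau> k + s)) = ?d t (\<tau> k + t)"
      using Lp_norm_shift_diff[of p t f 0 "\<tau> k"] by simp
    also have "\<dots> \<le> (1 / 2) ^ k"
      using T_pos[OF \<tau>(2,3) t] by (subst translation_dist_commute) (simp add: add_ac)
    also have "Lp_norm p {t..t + 1} (\<lambda>s. f (\<tau> k + s) - h s) \<le> 4 * (1 / 2) ^ k"
      using t \<tau>(3)[of k] by (intro close_h) auto
    finally show ?thesis by simp
  qed
  have transfer: "\<sigma> \<in> Bohr_periods p h e" if \<sigma>: "\<sigma> \<in> T B e" for \<sigma> B e
    unfolding Bohr_periods_iff
  proof
    fix t
    let ?E = "\<lambda>n t. Lp_norm p {t..t + 1} (\<lambda>s. f (\<tau> n + s) - h s)"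
    show "translation_dist p h (t + \<sigma>) t \<le> e"
    proof (rule tendsto_lowerbound[OF _ _ sequentially_bot])
      have "(\<lambda>n. e + ?E n (t + \<sigma>) + ?E n t) \<longlonglongrightarrow> e + 0 + 0"
        by (intro tendsto_add lim tendsto_const)
      then show "(\<lambda>n. e + ?E n (t + \<sigma>) + ?E n t) \<longlonglongrightarrow> e" by simp
      \<comment> \<open>The margin \<open>\<bar>\<sigma>\<bar>\<close> keeps both
        \<open>\<tau> n + t\<close> and \<open>\<tau> n + t + \<sigma>\<close> nonnegative and
        beyond \<open>B\<close>.\<close>
      obtain N where N: "\<And>n. n \<ge> N \<Longrightarrow> \<tau> n + t \<ge> max 0 B + \<bar>\<sigma>\<bar>" using far by blast
      show "\<forall>\<^sub>F n in sequentially. translation_dist p h (t + \<sigma>) t \<le> e + ?E n (t + \<sigma>) + ?E n t"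
        using eventually_ge_at_top[of N]
      proof eventually_elim
        case (elim n)
        have "\<tau> n + t \<in> I" "\<tau> n + t + \<sigma> \<in> I" "\<bar>\<tau> n + t\<bar> \<ge> B" "\<bar>\<tau> n + t + \<sigma>\<bar> \<ge> B"
          using N[OF elim] I0 by (auto simp: subset_iff)
        with \<sigma> have "?d (\<tau> n + t + \<sigma>) (\<tau> n + t) \<le> e" unfolding T_def by blast
        then have "translation_dist p (\<lambda>s. f (\<tau> n + s)) (t + \<sigma>) t \<le> e"
          by (simp add: translation_dist_def add_ac)
        then show ?case
          using translation_dist_perturb[OF p fL h, of "t + \<sigma>" t "\<tau> n"] by linarith
      qed
    qed
  qed
  have ap: "relatively_dense_in UNIV (Bohr_periods p h e)" if "0 < e" for e
  proof -
    from aap[OF that] obtain B where "relatively_dense_in I (T B e)" unfolding T_def by blast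
    then show ?thesis
      by (rule relatively_dense_in_half_line_symmetric[OF _ I0])
        (use that in \<open>auto intro: transfer Bohr_periods_uminus simp: Bohr_periods_iff[of 0]\<close>)
  qed
  have vanish: "\<exists>B. \<forall>t\<in>I. \<bar>t\<bar> \<ge> B \<longrightarrow> Lp_norm p {t..t + 1} (\<lambda>s. f s - h s) \<le> e" if e: "0 < e" for e
  proof -
    \<comment> \<open>The constant is 1 + 5 + 1: for negative \<open>t\<close> the comparison is
      made at \<open>t + \<sigma>\<close> to the right, where \<open>right\<close> costs 5, and
      \<open>\<sigma>\<close> is an approximate period of \<open>f\<close> and of \<open>h\<close>,
      costing 1 each.\<close>
    obtain k where k: "7 * (1 / 2) ^ k < e" using small[of e 7] e by auto
    have "Lp_norm p {t..t + 1} (\<lambda>s. f s - h s) \<le> e" if t: "t \<in> I" "\<bar>t\<bar> \<ge> M k" for t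
    proof (cases "t \<ge> 0")
      case True
      then have "Lp_norm p {t..t + 1} (\<lambda>s. f s - h s) \<le> 5 * (1 / 2) ^ k" using t by (intro right) auto
      also have "\<dots> \<le> 7 * (1 / 2) ^ k" by simp
      finally show ?thesis using k by simp
    next
      case False
      obtain \<sigma> where \<sigma>: "\<sigma> \<ge> M k - t" "\<sigma> \<in> T (M k) ((1 / 2) ^ k)" "\<sigma> \<ge> 0" using shift by blast
      have "t + \<sigma> \<in> I" using \<sigma>(1) M(1)[of k] I0 by (auto simp: subset_iff)
      then have 1: "?d t (t + \<sigma>) \<le> (1 / 2) ^ k"
        using \<sigma> t unfolding T_def by (subst translation_dist_commute) auto
      have 2: "Lp_norm p {t + \<sigma>..t + \<sigma> + 1} (\<lambda>s. f s - h s) \<le> 5 * (1 / 2) ^ k"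
        using \<sigma>(1) by (intro right) simp
      have 3: "translation_dist p h (t + \<sigma>) t \<le> (1 / 2) ^ k"
        using transfer[OF \<sigma>(2)] by (simp add: Bohr_periods_iff)
      have hL: "(\<lambda>s. h (b + s)) \<in> Lp_loc p UNIV" for b by (rule Lp_loc_UNIV_shift[OF h])
      have "Lp_norm p {t..t + 1} (\<lambda>s. f s - h s) = Lp_norm p {0..1} (\<lambda>s. f (t + s) - h (t + s))"
        using Lp_norm_shift[of p 0 1 "\<lambda>s. f s - h s" t] by simp
      also have "\<dots> \<le> ?d t (t + \<sigma>) + Lp_norm p {0..1} (\<lambda>s. f (t + \<sigma> + s) - h (t + s))"
        unfolding translation_dist_def by (intro Lp_norm_diff_triangle p fL hL)
      also have "Lp_norm p {0..1} (\<lambda>s. f (t + \<sigma> + s) - h (t + s))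
        \<le> Lp_norm p {0..1} (\<lambda>s. f (t + \<sigma> + s) - h (t + \<sigma> + s)) + translation_dist p h (t + \<sigma>) t"
        unfolding translation_dist_def by (intro Lp_norm_diff_triangle p fL hL)
      also have "Lp_norm p {0..1} (\<lambda>s. f (t + \<sigma> + s) - h (t + \<sigma> + s)) = Lp_norm p {t + \<sigma>..t + \<sigma> + 1} (\<lambda>s. f s - h s)"
        using Lp_norm_shift[of p 0 1 "\<lambda>s. f s - h s" "t + \<sigma>"] by simp
      finally show ?thesis using 1 2 3 k by linarith
    qed
    then show ?thesis by blast
  qed
  show ?thesis by (rule that[OF h ap vanish])
qed

section \<open>Extension by zero from a closed set\<close>

text \<open>A compact set meets the closed set \<open>I\<close> in a compact subset of
  \<open>I\<close>, so both sides test integrability on the same sets.\<close>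

lemma Lp_loc_restrict_iff:
  assumes "closed I"
  shows "f \<in> Lp_loc p I \<longleftrightarrow> (\<lambda>s. indicator I s *\<^sub>R f s) \<in> Lp_loc p UNIV"
proof -
  have I: "I \<in> sets lebesgue" using assms by (simp add: borel_closed)
  have eq: "set_integrable lebesgue K (\<lambda>s. norm (indicator I s *\<^sub>R f s) powr p)
      \<longleftrightarrow> set_integrable lebesgue (K \<inter> I) (\<lambda>s. norm (f s) powr p)" for K
    unfolding set_integrable_def
    by (intro arg_cong[where f = "integrable lebesgue"] ext) (auto simp: indicator_def)
  have "(\<forall>K. compact K \<and> K \<subseteq> I \<longrightarrow> set_integrable lebesgue K (\<lambda>s. norm (f s) powr p))
      \<longleftrightarrow> (\<forall>K. compact K \<longrightarrow> set_integrable lebesgue (K \<inter> I) (\<lambda>s. norm (f s) powr p))"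
    using assms by (metis Int_absorb2 compact_Int_closed inf_le2)
  then show ?thesis
    using strongly_measurable_restrict_iff[OF I, of f]
    unfolding Lp_loc_def mem_Collect_eq lebesgue_on_UNIV_eq eq by blast
qed

lemma Lp_loc_UNIV_subset:
  assumes "closed I" "f \<in> Lp_loc p UNIV"
  shows "f \<in> Lp_loc p I"
  unfolding Lp_loc_def
proof (intro CollectI conjI allI impI)
  show "strongly_measurable (lebesgue_on I) f"
    using assms by (simp add: strongly_measurable_restrict_iff borel_closed strongly_measurable_indicator Lp_loc_UNIV_iff)
  show "set_integrable lebesgue K (\<lambda>s. norm (f s) powr p)" if "compact K \<and> K \<subseteq> I" for K
    using assms(2) that by (simp add: Lp_loc_UNIV_iff Lp_on_def)
qed

lemma Lp_loc_diff:
  assumes "1 \<le> p" "closed I" "f \<in> Lp_loc p I" "g \<in> Lp_loc p I"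
  shows "(\<lambda>s. f s - g s) \<in> Lp_loc p I"
  using Lp_loc_UNIV_diff[OF assms(1), of "\<lambda>s. indicator I s *\<^sub>R f s" "\<lambda>s. indicator I s *\<^sub>R g s"] assms
  by (simp add: Lp_loc_restrict_iff[OF assms(2)] scaleR_diff_right)

lemma Lp_norm_cong_AE:
  assumes "Lp_on p A f" "Lp_on p A g" "AE s in lebesgue. s \<in> A \<longrightarrow> norm (f s) = norm (g s)"
  shows "Lp_norm p A f = Lp_norm p A g"
proof -
  have "(\<integral>s. indicator A s *\<^sub>R norm (f s) powr p \<partial>lebesgue) = (\<integral>s. indicator A s *\<^sub>R norm (g s) powr p \<partial>lebesgue)"
    using assms(1,2) unfolding Lp_on_def set_integrable_def
  proof (intro integral_cong_AE)
    show "AE s in lebesgue. indicator A s *\<^sub>R norm (f s) powr p = indicator A s *\<^sub>R norm (g s) powr p"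
      using assms(3) by eventually_elim (auto simp: indicator_def)
  qed auto
  then show ?thesis by (simp add: Lp_norm_def set_lebesgue_integral_def)
qed

subsection \<open>Stepanov classes\<close>

lemma Lp_norm_bochner_transform: "Lp_norm p {0..1} (bochner_transform f t) = Lp_norm p {t..t + 1} f"
  using Lp_norm_shift[of p 0 1 f t] by (simp add: bochner_transform_def)

context
  fixes I :: "real set"
  assumes I: "I = UNIV \<or> I = {0..}"
begin

lemma half_line_closed: "closed I"
  using I by auto

lemma half_line_add: "t \<in> I \<Longrightarrow> 0 \<le> s \<Longrightarrow> t + s \<in> I"
  using I by auto

lemma half_line_add': "t \<in> I \<Longrightarrow> s \<in> I \<Longrightarrow> t + s \<in> I"
  using I by auto

lemma half_line_nonneg: "{0..} \<subseteq> I"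
  using I by auto

lemma Lp_norm_restrict: "t \<in> I \<Longrightarrow> Lp_norm p {t..t + 1} (\<lambda>s. indicator I s *\<^sub>R f s) = Lp_norm p {t..t + 1} f"
  using I by (intro Lp_norm_cong) (auto simp: indicator_def)

lemma Lp_norm_bochner_transform_diff:
  assumes "t \<in> I" "u \<in> I"
  shows "Lp_norm p {0..1} (bochner_transform f t - bochner_transform f u)
    = translation_dist p (\<lambda>s. indicator I s *\<^sub>R f s) t u"
  unfolding translation_dist_def bochner_transform_def
  using half_line_add[OF assms(1)] half_line_add[OF assms(2)] by (intro Lp_norm_cong) simp

text \<open>Both windows, starting at \<open>t\<close> and at \<open>t + \<tau>\<close>, lie inside
  \<open>I\<close>, where \<open>f\<close> and its extension by zero coincide.\<close>

lemma translation_integral_le_iff: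
  assumes p: "1 \<le> p" and e: "0 \<le> e" and t: "t \<in> I" "t + \<tau> \<in> I"
  shows "(LINT s:{t..t + 1}|lebesgue. norm (f (s + \<tau>) - f s) powr p) \<le> e powr p
    \<longleftrightarrow> translation_dist p (\<lambda>s. indicator I s *\<^sub>R f s) (t + \<tau>) t \<le> e"
proof -
  have "Lp_norm p {t..t + 1} (\<lambda>s. f (s + \<tau>) - f s) = translation_dist p (\<lambda>s. indicator I s *\<^sub>R f s) (t + \<tau>) t"
    unfolding Lp_norm_shift_diff' translation_dist_def
    using half_line_add[OF t(1)] half_line_add[OF t(2)] by (intro Lp_norm_cong) simp
  then show ?thesis using Lp_norm_le_iff[OF p e, of "{t..t + 1}" "\<lambda>s. f (s + \<tau>) - f s"] by simp
qed

text \<open>Continuity of translations, applied to the extension by zero. It supplies the continuity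
  clauses of \<open>C0_wrt\<close> and of both notions of almost periodicity.\<close>

lemma continuous_bochner_transform:
  fixes f :: "real \<Rightarrow> 'a::banach"
  assumes p: "1 \<le> p" and f: "f \<in> Lp_loc p I"
  shows "continuous_wrt (Lp_norm p {0..1}) I (bochner_transform f)"
  unfolding continuous_wrt_def
proof
  fix t assume t: "t \<in> I"
  let ?f = "\<lambda>s. indicator I s *\<^sub>R f s"
  have "?f \<in> Lp_loc p UNIV" using f by (simp add: Lp_loc_restrict_iff[OF half_line_closed])
  then have "((\<lambda>s. translation_dist p ?f s t) \<longlongrightarrow> 0) (at t within I)"
    by (intro tendsto_within_subset[OF translation_dist_tendsto[OF p]]) auto
  then show "((\<lambda>s. Lp_norm p {0..1} (bochner_transform f s - bochner_transform f t)) \<longlongrightarrow> 0) (at t within I)"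
    by (rule Lim_transform_eventually)
      (use t in \<open>auto simp: eventually_at_filter Lp_norm_bochner_transform_diff\<close>)
qed

lemma bounded_bochner_transform:
  "f \<in> stepanov_bounded p I \<Longrightarrow> bounded_wrt (Lp_norm p {0..1}) I (bochner_transform f)"
  unfolding stepanov_bounded_def bounded_wrt_def Lp_norm_bochner_transform bdd_above_def by auto

lemma SpAAP_iff:
  fixes f :: "real \<Rightarrow> 'a::banach"
  assumes p: "1 \<le> p"
  shows "f \<in> SpAAP p I \<longleftrightarrow> f \<in> stepanov_bounded p I \<and> (\<forall>e>0. \<exists>M>0. relatively_dense_in I
    {\<tau>. \<forall>t\<in>I. t + \<tau> \<in> I \<and> \<bar>t\<bar> \<ge> M \<and> \<bar>t + \<tau>\<bar> \<ge> M \<longrightarrow>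
      translation_dist p (\<lambda>s. indicator I s *\<^sub>R f s) (t + \<tau>) t \<le> e})"
proof -
  have "{\<tau>. \<forall>t\<in>I. t + \<tau> \<in> I \<and> \<bar>t\<bar> \<ge> M \<and> \<bar>t + \<tau>\<bar> \<ge> M \<longrightarrow>
      Lp_norm p {0..1} (bochner_transform f (t + \<tau>) - bochner_transform f t) \<le> e} =
    {\<tau>. \<forall>t\<in>I. t + \<tau> \<in> I \<and> \<bar>t\<bar> \<ge> M \<and> \<bar>t + \<tau>\<bar> \<ge> M \<longrightarrow>
      translation_dist p (\<lambda>s. indicator I s *\<^sub>R f s) (t + \<tau>) t \<le> e}" for M e
    by (auto simp: Lp_norm_bochner_transform_diff)
  then show ?thesis
    using continuous_bochner_transform[OF p, of f] bounded_bochner_transform[of f p]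
    by (auto simp: SpAAP_def asymptotically_almost_periodic_wrt_def stepanov_bounded_def)
qed

text \<open>The integral and the pseudometric are compared only for \<open>\<tau> \<in> I\<close>,
  which ensures \<open>t + \<tau> \<in> I\<close>. This suffices, since relative density in
  \<open>I\<close> looks only at elements of \<open>I\<close>.\<close>

lemma SpQAAP_iff:
  fixes f :: "real \<Rightarrow> 'a::banach"
  assumes p: "1 \<le> p"
  shows "f \<in> SpQAAP p I \<longleftrightarrow> f \<in> stepanov_bounded p I \<and> (\<forall>e>0. relatively_dense_in I
    {\<tau>. \<exists>M>0. \<forall>t\<in>I. \<bar>t\<bar> \<ge> M \<longrightarrow> translation_dist p (\<lambda>s. indicator I s *\<^sub>R f s) (t + \<tau>) t \<le> e})"
proof -
  have *: "(\<exists>M>0. \<forall>t\<in>I. \<bar>t\<bar> \<ge> M \<longrightarrow> (LINT s:{t..t + 1}|lebesgue. norm (f (s + \<tau>) - f s) powr p) \<le> e powr p)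
    \<longleftrightarrow> (\<exists>M>0. \<forall>t\<in>I. \<bar>t\<bar> \<ge> M \<longrightarrow> translation_dist p (\<lambda>s. indicator I s *\<^sub>R f s) (t + \<tau>) t \<le> e)"
    if "0 < e" "\<tau> \<in> I" for e \<tau>
    using translation_integral_le_iff[OF p less_imp_le[OF that(1)] _ half_line_add'[OF _ that(2)]]
    by (intro ex_cong1 conj_cong ball_cong imp_cong refl) auto
  have "relatively_dense_in I {\<tau>. \<exists>M>0. \<forall>t\<in>I. \<bar>t\<bar> \<ge> M \<longrightarrow>
      (LINT s:{t..t + 1}|lebesgue. norm (f (s + \<tau>) - f s) powr p) \<le> e powr p}
    \<longleftrightarrow> relatively_dense_in I
      {\<tau>. \<exists>M>0. \<forall>t\<in>I. \<bar>t\<bar> \<ge> M \<longrightarrow> translation_dist p (\<lambda>s. indicator I s *\<^sub>R f s) (t + \<tau>) t \<le> e}"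
    if "0 < e" for e
  proof
    assume "relatively_dense_in I {\<tau>. \<exists>M>0. \<forall>t\<in>I. \<bar>t\<bar> \<ge> M \<longrightarrow>
      (LINT s:{t..t + 1}|lebesgue. norm (f (s + \<tau>) - f s) powr p) \<le> e powr p}"
    then show "relatively_dense_in I
      {\<tau>. \<exists>M>0. \<forall>t\<in>I. \<bar>t\<bar> \<ge> M \<longrightarrow> translation_dist p (\<lambda>s. indicator I s *\<^sub>R f s) (t + \<tau>) t \<le> e}"
      by (rule relatively_dense_in_mono) (simp only: mem_Collect_eq *[OF that])
  next
    assume "relatively_dense_in I
      {\<tau>. \<exists>M>0. \<forall>t\<in>I. \<bar>t\<bar> \<ge> M \<longrightarrow> translation_dist p (\<lambda>s. indicator I s *\<^sub>R f s) (t + \<tau>) t \<le> e}"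
    then show "relatively_dense_in I {\<tau>. \<exists>M>0. \<forall>t\<in>I. \<bar>t\<bar> \<ge> M \<longrightarrow>
      (LINT s:{t..t + 1}|lebesgue. norm (f (s + \<tau>) - f s) powr p) \<le> e powr p}"
      by (rule relatively_dense_in_mono) (simp only: mem_Collect_eq *[OF that])
  qed
  then show ?thesis by (auto simp: SpQAAP_def)
qed

lemma SpAAP_subset_SpQAAP:
  fixes f :: "real \<Rightarrow> 'a::banach"
  assumes p: "1 \<le> p" and f: "f \<in> SpAAP p I"
  shows "f \<in> SpQAAP p I"
  unfolding SpQAAP_iff[OF p]
proof (intro conjI allI impI)
  show "f \<in> stepanov_bounded p I" using f by (simp add: SpAAP_def)
  let ?d = "translation_dist p (\<lambda>s. indicator I s *\<^sub>R f s)"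
  fix e :: real assume "0 < e"
  then obtain M where M: "0 < M" "relatively_dense_in I
      {\<tau>. \<forall>t\<in>I. t + \<tau> \<in> I \<and> \<bar>t\<bar> \<ge> M \<and> \<bar>t + \<tau>\<bar> \<ge> M \<longrightarrow> ?d (t + \<tau>) t \<le> e}"
    using f unfolding SpAAP_iff[OF p] by blast
  from M(2) show "relatively_dense_in I {\<tau>. \<exists>M>0. \<forall>t\<in>I. \<bar>t\<bar> \<ge> M \<longrightarrow> ?d (t + \<tau>) t \<le> e}"
  proof (rule relatively_dense_in_mono)
    fix \<tau> assume \<tau>: "\<tau> \<in> I" "\<tau> \<in> {\<tau>. \<forall>t\<in>I. t + \<tau> \<in> I \<and> \<bar>t\<bar> \<ge> M \<and> \<bar>t + \<tau>\<bar> \<ge> M \<longrightarrow> ?d (t + \<tau>) t \<le> e}"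
    \<comment> \<open>The threshold of a quasi-asymptotic period may depend on
      \<open>\<tau>\<close>; enlarging it by \<open>\<bar>\<tau>\<bar>\<close> forces
      \<open>\<bar>t + \<tau>\<bar> \<ge> M\<close>.\<close>
    have "?d (t + \<tau>) t \<le> e" if "t \<in> I" "\<bar>t\<bar> \<ge> M + \<bar>\<tau>\<bar>" for t
      using \<tau>(2) that half_line_add'[OF that(1) \<tau>(1)] by auto
    then show "\<tau> \<in> {\<tau>. \<exists>M>0. \<forall>t\<in>I. \<bar>t\<bar> \<ge> M \<longrightarrow> ?d (t + \<tau>) t \<le> e}"
      using M(1) by (intro CollectI exI[of _ "M + \<bar>\<tau>\<bar>"]) auto
  qed
qed

text \<open>The decomposition is applied to the extension by zero \<open>u\<close>. Its almost
  periodic part \<open>h\<close> is almost automorphic by Bochner's criterion, and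
  \<open>q = f - h\<close> vanishes at infinity.\<close>

lemma SpAAP_subset_SpAAA:
  fixes f :: "real \<Rightarrow> 'a::banach"
  assumes p: "1 \<le> p" and f: "f \<in> SpAAP p I"
  shows "f \<in> SpAAA p I"
proof -
  have fb: "f \<in> stepanov_bounded p I" using f by (simp add: SpAAP_def)
  then have fI: "f \<in> Lp_loc p I" by (simp add: stepanov_bounded_def)
  define u where "u = (\<lambda>s. indicator I s *\<^sub>R f s)"
  have u: "u \<in> Lp_loc p UNIV" using fI by (simp add: Lp_loc_restrict_iff[OF half_line_closed] u_def)
  have aap: "\<exists>M>0. relatively_dense_in I
      {\<tau>. \<forall>t\<in>I. t + \<tau> \<in> I \<and> \<bar>t\<bar> \<ge> M \<and> \<bar>t + \<tau>\<bar> \<ge> M \<longrightarrow> translation_dist p u (t + \<tau>) t \<le> e}"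
    if "0 < e" for e
    using f that unfolding SpAAP_iff[OF p] u_def by blast
  from p u I aap show ?thesis
  proof (rule asymptotic_almost_periodic_decomposition)
    fix h :: "real \<Rightarrow> 'a"
    assume h: "h \<in> Lp_loc p UNIV" and ap: "\<And>e. 0 < e \<Longrightarrow> relatively_dense_in UNIV (Bohr_periods p h e)"
      and van: "\<And>e. 0 < e \<Longrightarrow> \<exists>M. \<forall>t\<in>I. \<bar>t\<bar> \<ge> M \<longrightarrow> Lp_norm p {t..t + 1} (\<lambda>s. u s - h s) \<le> e"
    define q where "q = (\<lambda>s. f s - h s)"
    have qI: "q \<in> Lp_loc p I"
      unfolding q_def by (rule Lp_loc_diff[OF p half_line_closed fI Lp_loc_UNIV_subset[OF half_line_closed h]])
    have uhL: "(\<lambda>s. u s - h s) \<in> Lp_loc p UNIV" by (intro Lp_loc_UNIV_diff p u h)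
    have q: "Lp_norm p {t..t + 1} q = Lp_norm p {t..t + 1} (\<lambda>s. u s - h s)" if "t \<in> I" for t
      using I that unfolding q_def u_def by (intro Lp_norm_cong) (auto simp: indicator_def)
    obtain M where M: "\<And>t. t \<in> I \<Longrightarrow> \<bar>t\<bar> \<ge> M \<Longrightarrow> Lp_norm p {t..t + 1} (\<lambda>s. u s - h s) \<le> 1"
      using van[OF zero_less_one] by blast
    \<comment> \<open>Windows starting beyond \<open>M\<close> are controlled by the decay of
      \<open>u - h\<close>; all others lie in one bounded interval.\<close>
    have bd: "Lp_norm p {t..t + 1} q \<le> max 1 (Lp_norm p {- M..M + 1} (\<lambda>s. u s - h s))" if t: "t \<in> I" for t
    proof (cases "\<bar>t\<bar> \<ge> M")
      case True
      with M t show ?thesis by (simp add: q le_max_iff_disj)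
    next
      case False
      then have "Lp_norm p {t..t + 1} (\<lambda>s. u s - h s) \<le> Lp_norm p {- M..M + 1} (\<lambda>s. u s - h s)"
        by (intro Lp_norm_mono_set p Lp_loc_UNIV_imp_Lp_on uhL) auto
      with t show ?thesis by (simp add: q le_max_iff_disj)
    qed
    then have qb: "q \<in> stepanov_bounded p I"
      using qI unfolding stepanov_bounded_def by (auto intro!: bdd_aboveI2)
    have "((\<lambda>t. Lp_norm p {0..1} (bochner_transform q t)) \<longlongrightarrow> 0) (inf at_infinity (principal I))"
      unfolding Lp_norm_bochner_transform
    proof (rule tendstoI)
      fix e :: real assume e: "0 < e"
      then obtain B where B: "\<And>t. t \<in> I \<Longrightarrow> \<bar>t\<bar> \<ge> B \<Longrightarrow> Lp_norm p {t..t + 1} (\<lambda>s. u s - h s) \<le> e / 2"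
        using van[of "e / 2"] by auto
      have "t \<in> I \<longrightarrow> dist (Lp_norm p {t..t + 1} q) 0 < e" if "norm t \<ge> B" for t
        using B[of t] q[of t] that e by (auto simp: dist_real_def)
      then show "\<forall>\<^sub>F t in inf at_infinity (principal I). dist (Lp_norm p {t..t + 1} q) 0 < e"
        unfolding eventually_inf_principal eventually_at_infinity by blast
    qed
    then have "bochner_transform q \<in> C0_wrt (Lp_norm p {0..1}) I"
      using continuous_bochner_transform[OF p qI] bounded_bochner_transform[OF qb] by (simp add: C0_wrt_def)
    moreover have "h \<in> SpAA p" by (rule Bohr_imp_SpAA[OF p h ap])
    ultimately show "f \<in> SpAAA p I"
      unfolding SpAAA_def using fb qb
      by (intro CollectI conjI bexI[where x = h] bexI[where x = q]) (auto simp: q_def)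
  qed
qed

text \<open>The threshold of a quasi-asymptotic period depends on the period. It is used only to
  show that \<open>\<tau>\<close> is a Bohr period of \<open>h\<close>, after which the decay of
  \<open>q\<close> alone determines a threshold common to all \<open>\<tau>\<close>.\<close>

lemma SpAAA_SpQAAP_subset_SpAAP:
  fixes f :: "real \<Rightarrow> 'a::banach"
  assumes p: "1 \<le> p" and aaa: "f \<in> SpAAA p I" and qaap: "f \<in> SpQAAP p I"
  shows "f \<in> SpAAP p I"
proof -
  have fb: "f \<in> stepanov_bounded p I" using aaa by (simp add: SpAAA_def)
  define u where "u = (\<lambda>s. indicator I s *\<^sub>R f s)"
  have u: "u \<in> Lp_loc p UNIV"
    using fb by (simp add: Lp_loc_restrict_iff[OF half_line_closed, symmetric] u_def stepanov_bounded_def)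
  obtain h q where h: "h \<in> SpAA p" and qb: "q \<in> stepanov_bounded p I"
    and C0: "bochner_transform q \<in> C0_wrt (Lp_norm p {0..1}) I"
    and eq: "AE t in lebesgue_on I. f t = h t + q t"
    using aaa unfolding SpAAA_def by blast
  have hL: "h \<in> Lp_loc p UNIV" using h by (simp add: SpAA_def)
  define w where "w = (\<lambda>s. indicator I s *\<^sub>R q s)"
  have w: "w \<in> Lp_loc p UNIV"
    using qb by (simp add: Lp_loc_restrict_iff[OF half_line_closed, symmetric] w_def stepanov_bounded_def)
  have ae: "AE s in lebesgue. s \<in> I \<longrightarrow> u s - h s = w s"
    using eq half_line_closed unfolding u_def w_def
    by (auto simp: AE_restrict_space_iff borel_closed elim!: eventually_mono)
  have E: "Lp_norm p {t..t + 1} (\<lambda>s. u s - h s) = Lp_norm p {t..t + 1} q" if t: "t \<in> I" for t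
  proof -
    have "{t..t + 1} \<subseteq> I" using I t by auto
    then have "AE s in lebesgue. s \<in> {t..t + 1} \<longrightarrow> norm (u s - h s) = norm (w s)"
      using ae by (auto elim!: eventually_mono)
    then have "Lp_norm p {t..t + 1} (\<lambda>s. u s - h s) = Lp_norm p {t..t + 1} w"
      by (intro Lp_norm_cong_AE Lp_loc_UNIV_imp_Lp_on Lp_loc_UNIV_diff p u hL w)
    also have "\<dots> = Lp_norm p {t..t + 1} q" unfolding w_def by (rule Lp_norm_restrict[OF t])
    finally show ?thesis .
  qed
  show ?thesis unfolding SpAAP_iff[OF p] u_def[symmetric]
  proof (intro conjI allI impI fb)
    fix \<epsilon> :: real assume "0 < \<epsilon>"
    \<comment> \<open>Passing from \<open>u\<close> to \<open>h\<close> turns \<open>e\<close> into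
      \<open>3 * e\<close>, by the errors on two windows; returning to \<open>u\<close> adds two
      more.\<close>
    define e where "e = \<epsilon> / 5"
    have e: "0 < e" using \<open>0 < \<epsilon>\<close> by (simp add: e_def)
    have "((\<lambda>t. Lp_norm p {t..t + 1} q) \<longlongrightarrow> 0) (inf at_infinity (principal I))"
      using C0 by (simp add: C0_wrt_def Lp_norm_bochner_transform)
    from order_tendstoD(2)[OF this e] obtain B where B: "\<And>t. t \<in> I \<Longrightarrow> \<bar>t\<bar> \<ge> B \<Longrightarrow> Lp_norm p {t..t + 1} (\<lambda>s. u s - h s) < e"
      unfolding eventually_inf_principal eventually_at_infinity using E by auto
    have rd: "relatively_dense_in I {\<tau>. \<exists>M>0. \<forall>t\<in>I. \<bar>t\<bar> \<ge> M \<longrightarrow> translation_dist p u (t + \<tau>) t \<le> e}"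
      using qaap e unfolding SpQAAP_iff[OF p] u_def by blast
    have "relatively_dense_in I {\<tau>. \<forall>t\<in>I. t + \<tau> \<in> I \<and> \<bar>t\<bar> \<ge> max 1 B \<and> \<bar>t + \<tau>\<bar> \<ge> max 1 B \<longrightarrow>
        translation_dist p u (t + \<tau>) t \<le> \<epsilon>}"
      using rd
    proof (rule relatively_dense_in_mono)
      fix \<tau> assume \<tau>I: "\<tau> \<in> I"
        and "\<tau> \<in> {\<tau>. \<exists>M>0. \<forall>t\<in>I. \<bar>t\<bar> \<ge> M \<longrightarrow> translation_dist p u (t + \<tau>) t \<le> e}"
      then obtain M where M: "0 < M" "\<And>t. t \<in> I \<Longrightarrow> \<bar>t\<bar> \<ge> M \<Longrightarrow> translation_dist p u (t + \<tau>) t \<le> e" by blast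
      have "\<tau> \<in> Bohr_periods p h (3 * e)"
      proof (rule SpAA_asymptotic_period[OF p h])
        \<comment> \<open>Beyond this bound \<open>t\<close> passes the threshold of
          \<open>\<tau>\<close>, and both windows lie where \<open>q\<close> is small.\<close>
        fix t assume t: "t \<ge> max M (max 0 B + \<bar>\<tau>\<bar>)"
        have tI: "t \<in> I" "t + \<tau> \<in> I" using t half_line_nonneg by (auto simp: subset_iff)
        have "translation_dist p h (t + \<tau>) t \<le> translation_dist p u (t + \<tau>) t
          + Lp_norm p {t + \<tau>..t + \<tau> + 1} (\<lambda>s. u s - h s) + Lp_norm p {t..t + 1} (\<lambda>s. u s - h s)"
          by (rule translation_dist_perturb[OF p u hL])
        also have "\<dots> \<le> e + e + e"
          using t tI by (intro add_mono M(2) less_imp_le[OF B]) auto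
        finally show "translation_dist p h (t + \<tau>) t \<le> 3 * e" by simp
      qed
      then have per: "translation_dist p h (t + \<tau>) t \<le> 3 * e" for t by (simp add: Bohr_periods_iff)
      have "translation_dist p u (t + \<tau>) t \<le> \<epsilon>"
        if t: "t \<in> I" "t + \<tau> \<in> I" "\<bar>t\<bar> \<ge> max 1 B" "\<bar>t + \<tau>\<bar> \<ge> max 1 B" for t
      proof -
        have "translation_dist p u (t + \<tau>) t \<le> translation_dist p h (t + \<tau>) t
          + Lp_norm p {t + \<tau>..t + \<tau> + 1} (\<lambda>s. h s - u s) + Lp_norm p {t..t + 1} (\<lambda>s. h s - u s)"
          by (rule translation_dist_perturb[OF p hL u])
        also have "\<dots> \<le> 3 * e + e + e"
          unfolding Lp_norm_minus_commute[of p _ h u]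
          using t by (intro add_mono per less_imp_le[OF B]) auto
        finally show ?thesis by (simp add: e_def)
      qed
      then show "\<tau> \<in> {\<tau>. \<forall>t\<in>I. t + \<tau> \<in> I \<and> \<bar>t\<bar> \<ge> max 1 B \<and> \<bar>t + \<tau>\<bar> \<ge> max 1 B \<longrightarrow>
        translation_dist p u (t + \<tau>) t \<le> \<epsilon>}" by blast
    qed
    then show "\<exists>M>0. relatively_dense_in I {\<tau>. \<forall>t\<in>I. t + \<tau> \<in> I \<and> \<bar>t\<bar> \<ge> M \<and> \<bar>t + \<tau>\<bar> \<ge> M \<longrightarrow>
        translation_dist p u (t + \<tau>) t \<le> \<epsilon>}"
      by (intro exI[of _ "max 1 B"]) simp
  qed
qed

end

section \<open>Almost periodic functions on the whole line\<close>

text \<open>Symmetry of the Bohr periods allows density of the positive ones in the half-line to be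
  replaced by density of all of them in the line.\<close>

lemma SpAP_iff:
  fixes f :: "real \<Rightarrow> 'a::banach"
  assumes p: "1 \<le> p"
  shows "f \<in> SpAP p UNIV \<longleftrightarrow>
    f \<in> stepanov_bounded p UNIV \<and> (\<forall>e>0. relatively_dense_in UNIV (Bohr_periods p f e))"
proof -
  have dist: "Lp_norm p {0..1} (bochner_transform f t - bochner_transform f u) = translation_dist p f t u" for t u
    using Lp_norm_bochner_transform_diff[of UNIV t u p f] by simp
  have "relatively_dense_in {0..} {\<tau>. \<tau> > 0 \<and> \<tau> \<in> Bohr_periods p f e} \<longleftrightarrow> relatively_dense_in UNIV (Bohr_periods p f e)"
    if e: "0 < e" for e
  proof
    assume "relatively_dense_in {0..} {\<tau>. \<tau> > 0 \<and> \<tau> \<in> Bohr_periods p f e}"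
    then show "relatively_dense_in UNIV (Bohr_periods p f e)"
      by (rule relatively_dense_in_half_line_symmetric) (use e in \<open>auto intro: Bohr_periods_uminus simp: Bohr_periods_iff[of 0]\<close>)
  next
    assume "relatively_dense_in UNIV (Bohr_periods p f e)"
    then obtain l where l: "0 < l" "\<And>a. \<exists>\<tau>\<in>{a..a + l}. \<tau> \<in> Bohr_periods p f e"
      unfolding relatively_dense_in_UNIV_iff by blast
    \<comment> \<open>The length grows by one so that the search can start at \<open>a + 1\<close>,
      which excludes the period zero.\<close>
    have "\<exists>\<tau>\<in>{a..a + (l + 1)}. \<tau> \<in> {\<tau>. \<tau> > 0 \<and> \<tau> \<in> Bohr_periods p f e}" if "{a..a + (l + 1)} \<subseteq> {0..}" for a
    proof -
      have "a \<in> {a..a + (l + 1)}" using l(1) by simp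
      with that have "0 \<le> a" by auto
      moreover obtain \<tau> where "\<tau> \<in> {a + 1..a + 1 + l}" "\<tau> \<in> Bohr_periods p f e" using l(2) by blast
      ultimately show ?thesis by (intro bexI[of _ \<tau>]) auto
    qed
    with l(1) show "relatively_dense_in {0..} {\<tau>. \<tau> > 0 \<and> \<tau> \<in> Bohr_periods p f e}"
      unfolding relatively_dense_in_def by (intro exI[of _ "l + 1"]) auto
  qed
  then show ?thesis
    using continuous_bochner_transform[of UNIV p f] p
    by (auto simp: SpAP_def almost_periodic_wrt_def stepanov_bounded_def dist Bohr_periods_def)
qed

text \<open>On the line, quasi-asymptotic periods of an almost automorphic function are Bohr
  periods. Conversely, almost periodicity gives almost automorphy by Bochner's criterion, and a Bohr
  period satisfies the quasi-asymptotic condition with any threshold.\<close>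

lemma SpAP_eq:
  fixes p :: real
  assumes p: "1 \<le> p"
  shows "(SpAA p :: (real \<Rightarrow> 'a::banach) set) \<inter> SpQAAP p UNIV = SpAP p UNIV"
proof (intro equalityI subsetI)
  fix f :: "real \<Rightarrow> 'a" assume f: "f \<in> SpAA p \<inter> SpQAAP p UNIV"
  then have fb: "f \<in> stepanov_bounded p UNIV" by (simp add: SpQAAP_def)
  have "relatively_dense_in UNIV (Bohr_periods p f e)" if "0 < e" for e
  proof -
    have "relatively_dense_in UNIV {\<tau>. \<exists>M>0. \<forall>t. \<bar>t\<bar> \<ge> M \<longrightarrow> translation_dist p f (t + \<tau>) t \<le> e}"
      using f that by (simp add: SpQAAP_iff[OF _ p])
    then show ?thesis
    proof (rule relatively_dense_in_mono)
      fix \<tau> assume "\<tau> \<in> {\<tau>. \<exists>M>0. \<forall>t. \<bar>t\<bar> \<ge> M \<longrightarrow> translation_dist p f (t + \<tau>) t \<le> e}"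
      then obtain M where "\<And>t. \<bar>t\<bar> \<ge> M \<Longrightarrow> translation_dist p f (t + \<tau>) t \<le> e" by blast
      with f show "\<tau> \<in> Bohr_periods p f e"
        by (intro SpAA_asymptotic_period[OF p, where M = M]) auto
    qed
  qed
  with fb show "f \<in> SpAP p UNIV" by (simp add: SpAP_iff[OF p])
next
  fix f :: "real \<Rightarrow> 'a" assume "f \<in> SpAP p UNIV"
  then have fb: "f \<in> stepanov_bounded p UNIV"
    and ap: "\<And>e. 0 < e \<Longrightarrow> relatively_dense_in UNIV (Bohr_periods p f e)" by (simp_all add: SpAP_iff[OF p])
  have "f \<in> SpAA p"
    using fb by (intro Bohr_imp_SpAA p ap) (simp_all add: stepanov_bounded_def)
  moreover have "relatively_dense_in UNIV {\<tau>. \<exists>M>0. \<forall>t. \<bar>t\<bar> \<ge> M \<longrightarrow> translation_dist p f (t + \<tau>) t \<le> e}" if "0 < e" for e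
    using ap[OF that] by (rule relatively_dense_in_mono) (auto simp: Bohr_periods_iff intro!: exI[of _ 1])
  then have "f \<in> SpQAAP p UNIV" using fb by (simp add: SpQAAP_iff[OF _ p])
  ultimately show "f \<in> SpAA p \<inter> SpQAAP p UNIV" by blast
qed

theorem theorem2p10:
  fixes p :: real
  assumes nontrivial: "\<exists>x::'a::complex_banach. x \<noteq> 0"
    and p: "1 \<le> p"
  shows "(\<forall>I::real set. I = UNIV \<or> I = {0..} \<longrightarrow>
            (SpAAA p I :: (real \<Rightarrow> 'a) set) \<inter> SpQAAP p I = SpAAP p I \<and>
            ((SpAAA p I :: (real \<Rightarrow> 'a) set) - SpAAP p I) \<inter> SpQAAP p I = {}) \<and>
         (SpAA p :: (real \<Rightarrow> 'a) set) \<inter> SpQAAP p UNIV = SpAP p UNIV"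
proof (intro conjI allI impI)
  show "(SpAA p :: (real \<Rightarrow> 'a) set) \<inter> SpQAAP p UNIV = SpAP p UNIV"
    by (rule SpAP_eq[OF p])
  fix I :: "real set" assume I: "I = UNIV \<or> I = {0..}"
  show "(SpAAA p I :: (real \<Rightarrow> 'a) set) \<inter> SpQAAP p I = SpAAP p I"
    using SpAAP_subset_SpAAA[OF I p] SpAAP_subset_SpQAAP[OF I p] SpAAA_SpQAAP_subset_SpAAP[OF I p] by blast
  then show "((SpAAA p I :: (real \<Rightarrow> 'a) set) - SpAAP p I) \<inter> SpQAAP p I = {}" by blast
qed

end
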